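(* Let $\Gamma$ be a torsion-free abelian group and let $D$ be a $\Gamma$-graded division algebra over its centre $F$, where $F$ is Noetherian as a ring. Then $$\frac{D}{[D,D]} \otimes_F QF \;\cong\; \frac{QD}{[QD,QD]}$$ as $QF$-vector spaces.
   Context: A $\Gamma$-graded ring is $D = \bigoplus_{\gamma\in\Gamma} D_\gamma$ with $D_\gamma D_\delta \subseteq D_{\gamma+\delta}$; homogeneous elements are those in $\bigcup_\gamma D_\gamma$. A graded division ring is a graded ring in which every non-zero homogeneous element is invertible; a graded field is a commutative graded division ring. A graded division algebra $D$ over its centre $F$ is a graded division ring with centre $F$ (a graded field) such that $[D:F]<\infty$. $[D,D]$ is the graded submodule of $D$ generated by all homogeneous additive commutators $ab-ba$ ($a,b\in D$ homogeneous); $[QD,QD]$ is the submodule generated by all additive commutators of $QD$. Since $\Gamma$ is torsion-free abelian, $F$ is an integral domain; $QF = (F\setminus 0)^{-1}F$ is its quotient field, and $QD = QF\otimes_F D$ is the quotient division ring of $D$. *)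

theory Defs
  imports "HOL-Algebra.Algebra"
begin

section \<open>Graded division algebras\<close>

definition torsion_free :: "('g, 'z) monoid_scheme \<Rightarrow> bool" where
  "torsion_free G \<longleftrightarrow>
     (\<forall>x\<in>carrier G. \<forall>n::nat. 0 < n \<longrightarrow> x [^]\<^bsub>G\<^esub> n = \<one>\<^bsub>G\<^esub> \<longrightarrow> x = \<one>\<^bsub>G\<^esub>)"

text \<open>The grading group is written multiplicatively; the component of degree \<open>\<gamma>\<close> is \<open>C \<gamma>\<close>.
  The finite support has to be explicit, since an infinite \<^const>\<open>finsum\<close> is zero by
  convention.\<close>

definition homogeneous_decomposition ::
  "('g, 'z) monoid_scheme \<Rightarrow> ('g \<Rightarrow> 'd set) \<Rightarrow> ('d, 'y) ring_scheme \<Rightarrow> 'd \<Rightarrow> ('g \<Rightarrow> 'd) \<Rightarrow> bool" where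
  "homogeneous_decomposition \<Gamma> C D x f \<longleftrightarrow>
     f \<in> (\<Pi>\<^sub>E \<gamma>\<in>carrier \<Gamma>. C \<gamma>) \<and>
     finite {\<gamma>\<in>carrier \<Gamma>. f \<gamma> \<noteq> \<zero>\<^bsub>D\<^esub>} \<and>
     x = (\<Oplus>\<^bsub>D\<^esub> \<gamma>\<in>{\<gamma>\<in>carrier \<Gamma>. f \<gamma> \<noteq> \<zero>\<^bsub>D\<^esub>}. f \<gamma>)"

definition graded_ring ::
  "('g, 'z) monoid_scheme \<Rightarrow> ('g \<Rightarrow> 'd set) \<Rightarrow> ('d, 'y) ring_scheme \<Rightarrow> bool" where
  "graded_ring \<Gamma> C D \<longleftrightarrow>
     ring D \<and>
     (\<forall>\<gamma>\<in>carrier \<Gamma>. additive_subgroup (C \<gamma>) D) \<and>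
     (\<forall>x\<in>carrier D. \<exists>!f. homogeneous_decomposition \<Gamma> C D x f) \<and>
     (\<forall>\<gamma>\<in>carrier \<Gamma>. \<forall>\<delta>\<in>carrier \<Gamma>. \<forall>x\<in>C \<gamma>. \<forall>y\<in>C \<delta>. x \<otimes>\<^bsub>D\<^esub> y \<in> C (\<gamma> \<otimes>\<^bsub>\<Gamma>\<^esub> \<delta>))"

definition homogeneous_elements :: "('g, 'z) monoid_scheme \<Rightarrow> ('g \<Rightarrow> 'd set) \<Rightarrow> 'd set" where
  "homogeneous_elements \<Gamma> C = (\<Union>\<gamma>\<in>carrier \<Gamma>. C \<gamma>)"

text \<open>As for division rings, the zero ring is excluded.\<close>

definition graded_division_ring ::
  "('g, 'z) monoid_scheme \<Rightarrow> ('g \<Rightarrow> 'd set) \<Rightarrow> ('d, 'y) ring_scheme \<Rightarrow> bool" where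
  "graded_division_ring \<Gamma> C D \<longleftrightarrow>
     graded_ring \<Gamma> C D \<and> \<one>\<^bsub>D\<^esub> \<noteq> \<zero>\<^bsub>D\<^esub> \<and>
     (\<forall>x\<in>homogeneous_elements \<Gamma> C. x \<noteq> \<zero>\<^bsub>D\<^esub> \<longrightarrow> x \<in> Units D)"

definition ring_centre :: "('d, 'y) ring_scheme \<Rightarrow> ('d, 'y) ring_scheme" where
  "ring_centre D =
     D\<lparr>carrier := {z\<in>carrier D. \<forall>x\<in>carrier D. z \<otimes>\<^bsub>D\<^esub> x = x \<otimes>\<^bsub>D\<^esub> z}\<rparr>"

text \<open>A ring \<open>A\<close> as a module over another ring along the map \<open>\<phi>\<close>. In particular
  \<open>restrict_scalars id A\<close> is \<open>A\<close> as a module over itself or over one of its subrings.\<close>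

definition restrict_scalars :: "('r \<Rightarrow> 'a) \<Rightarrow> ('a, 'y) ring_scheme \<Rightarrow> ('r, 'a) module" where
  "restrict_scalars \<phi> A =
     ring.extend (ring.truncate A) (module.fields (\<lambda>r a. \<phi> r \<otimes>\<^bsub>A\<^esub> a))"

definition finite_module_basis ::
  "('r, 'x) ring_scheme \<Rightarrow> ('r, 'm, 'y) module_scheme \<Rightarrow> 'm set \<Rightarrow> bool" where
  "finite_module_basis R M B \<longleftrightarrow>
     finite B \<and> B \<subseteq> carrier M \<and>
     (\<forall>x\<in>carrier M. \<exists>!c. c \<in> B \<rightarrow>\<^sub>E carrier R \<and> x = (\<Oplus>\<^bsub>M\<^esub> b\<in>B. c b \<odot>\<^bsub>M\<^esub> b))"

text \<open>A graded module over a graded field has a basis of homogeneous elements, whose cardinality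
  is its dimension; hence finite dimension is the existence of a finite such basis.\<close>

definition graded_division_algebra ::
  "('g, 'z) monoid_scheme \<Rightarrow> ('g \<Rightarrow> 'd set) \<Rightarrow> ('d, 'y) ring_scheme \<Rightarrow> ('d, 'y) ring_scheme \<Rightarrow> bool" where
  "graded_division_algebra \<Gamma> C D F \<longleftrightarrow>
     graded_division_ring \<Gamma> C D \<and> F = ring_centre D \<and>
     (\<exists>B \<subseteq> homogeneous_elements \<Gamma> C. finite_module_basis F (restrict_scalars id D) B)"


section \<open>Localization and quotient field\<close>

definition fraction_rel :: "('a, 'x) ring_scheme \<Rightarrow> 'a set \<Rightarrow> (('a \<times> 'a) \<times> ('a \<times> 'a)) set" where
  "fraction_rel R S =
     {((a, s), (b, t)). a \<in> carrier R \<and> b \<in> carrier R \<and> s \<in> S \<and> t \<in> S \<and>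
        (\<exists>u\<in>S. u \<otimes>\<^bsub>R\<^esub> (a \<otimes>\<^bsub>R\<^esub> t) = u \<otimes>\<^bsub>R\<^esub> (b \<otimes>\<^bsub>R\<^esub> s))}"

definition fraction :: "('a, 'x) ring_scheme \<Rightarrow> 'a set \<Rightarrow> 'a \<Rightarrow> 'a \<Rightarrow> ('a \<times> 'a) set" where
  "fraction R S a s = fraction_rel R S `` {(a, s)}"

text \<open>Here, as for \<^const>\<open>FactRing\<close>, an operation on classes is the union of the resulting classes
  over all representatives; this union is a single class whenever the operation is well defined.\<close>

definition localization :: "('a, 'x) ring_scheme \<Rightarrow> 'a set \<Rightarrow> ('a \<times> 'a) set ring" where
  "localization R S =
     \<lparr>carrier = (carrier R \<times> S) // fraction_rel R S,
      monoid.mult = (\<lambda>U V. \<Union>(a, s)\<in>U. \<Union>(b, t)\<in>V. fraction R S (a \<otimes>\<^bsub>R\<^esub> b) (s \<otimes>\<^bsub>R\<^esub> t)),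
      monoid.one = fraction R S \<one>\<^bsub>R\<^esub> \<one>\<^bsub>R\<^esub>,
      ring.zero = fraction R S \<zero>\<^bsub>R\<^esub> \<one>\<^bsub>R\<^esub>,
      ring.add = (\<lambda>U V. \<Union>(a, s)\<in>U. \<Union>(b, t)\<in>V.
               fraction R S (a \<otimes>\<^bsub>R\<^esub> t \<oplus>\<^bsub>R\<^esub> b \<otimes>\<^bsub>R\<^esub> s) (s \<otimes>\<^bsub>R\<^esub> t))\<rparr>"

definition quotient_field :: "('a, 'x) ring_scheme \<Rightarrow> ('a \<times> 'a) set ring" where
  "quotient_field R = localization R (carrier R - {\<zero>\<^bsub>R\<^esub>})"

definition to_quotient_field :: "('a, 'x) ring_scheme \<Rightarrow> 'a \<Rightarrow> ('a \<times> 'a) set" where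
  "to_quotient_field R a = fraction R (carrier R - {\<zero>\<^bsub>R\<^esub>}) a \<one>\<^bsub>R\<^esub>"


section \<open>Quotient modules and tensor products\<close>

text \<open>Only the additive group and the scalar action of a quotient module are meaningful, unless
  \<open>N\<close> is a two-sided ideal.\<close>

definition quotient_module :: "('r, 'm, 'y) module_scheme \<Rightarrow> 'm set \<Rightarrow> ('r, 'm set) module" where
  "quotient_module M N =
     ring.extend (M Quot N) (module.fields (\<lambda>r U. \<Union>x\<in>U. N +>\<^bsub>M\<^esub> (r \<odot>\<^bsub>M\<^esub> x)))"

text \<open>\<open>M \<otimes>\<^sub>R N\<close> is the free abelian group on \<open>M \<times> N\<close> modulo the subgroup generated by the usual
  relations.\<close>

definition tensor_relations ::
  "('r, 'x) ring_scheme \<Rightarrow> ('r, 'm, 'y) module_scheme \<Rightarrow> ('r, 'n, 'z) module_scheme \<Rightarrow>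
   (('m \<times> 'n) \<Rightarrow>\<^sub>0 int) set" where
  "tensor_relations R M N =
     {frag_of (x \<oplus>\<^bsub>M\<^esub> x', y) - frag_of (x, y) - frag_of (x', y) | x x' y.
        x \<in> carrier M \<and> x' \<in> carrier M \<and> y \<in> carrier N} \<union>
     {frag_of (x, y \<oplus>\<^bsub>N\<^esub> y') - frag_of (x, y) - frag_of (x, y') | x y y'.
        x \<in> carrier M \<and> y \<in> carrier N \<and> y' \<in> carrier N} \<union>
     {frag_of (r \<odot>\<^bsub>M\<^esub> x, y) - frag_of (x, r \<odot>\<^bsub>N\<^esub> y) | r x y.
        r \<in> carrier R \<and> x \<in> carrier M \<and> y \<in> carrier N}"

definition tensor_kernel ::
  "('r, 'x) ring_scheme \<Rightarrow> ('r, 'm, 'y) module_scheme \<Rightarrow> ('r, 'n, 'z) module_scheme \<Rightarrow>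
   (('m \<times> 'n) \<Rightarrow>\<^sub>0 int) set" where
  "tensor_kernel R M N =
     generate (free_Abelian_group (carrier M \<times> carrier N)) (tensor_relations R M N)"

definition tensor_class ::
  "('r, 'x) ring_scheme \<Rightarrow> ('r, 'm, 'y) module_scheme \<Rightarrow> ('r, 'n, 'z) module_scheme \<Rightarrow>
   (('m \<times> 'n) \<Rightarrow>\<^sub>0 int) \<Rightarrow> (('m \<times> 'n) \<Rightarrow>\<^sub>0 int) set" where
  "tensor_class R M N u =
     tensor_kernel R M N #>\<^bsub>free_Abelian_group (carrier M \<times> carrier N)\<^esub> u"

text \<open>The multiplication is \<open>(x \<otimes> y) (x' \<otimes> y') = x x' \<otimes> y y'\<close>, extended biadditively. It is meaningful
  only when \<open>M\<close> and \<open>N\<close> are \<open>R\<close>-algebras.\<close>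

definition tensor_product ::
  "('r, 'x) ring_scheme \<Rightarrow> ('r, 'm, 'y) module_scheme \<Rightarrow> ('r, 'n, 'z) module_scheme \<Rightarrow>
   (('m \<times> 'n) \<Rightarrow>\<^sub>0 int) set ring" where
  "tensor_product R M N =
     (let G = free_Abelian_group (carrier M \<times> carrier N) Mod tensor_kernel R M N
      in \<lparr>carrier = carrier G,
          monoid.mult = (\<lambda>U V. \<Union>u\<in>U. \<Union>v\<in>V. tensor_class R M N
                    (frag_extend (\<lambda>(x, y).
                       frag_extend (\<lambda>(x', y'). frag_of (x \<otimes>\<^bsub>M\<^esub> x', y \<otimes>\<^bsub>N\<^esub> y')) v) u)),
          monoid.one = tensor_class R M N (frag_of (\<one>\<^bsub>M\<^esub>, \<one>\<^bsub>N\<^esub>)),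
          ring.zero = \<one>\<^bsub>G\<^esub>,
          ring.add = monoid.mult G\<rparr>)"

text \<open>The endomorphism \<open>f \<otimes> g\<close> of \<open>M \<otimes>\<^sub>R N\<close>.\<close>

definition tensor_map ::
  "('r, 'x) ring_scheme \<Rightarrow> ('r, 'm, 'y) module_scheme \<Rightarrow> ('r, 'n, 'z) module_scheme \<Rightarrow>
   ('m \<Rightarrow> 'm) \<Rightarrow> ('n \<Rightarrow> 'n) \<Rightarrow> (('m \<times> 'n) \<Rightarrow>\<^sub>0 int) set \<Rightarrow> (('m \<times> 'n) \<Rightarrow>\<^sub>0 int) set" where
  "tensor_map R M N f g U =
     (\<Union>u\<in>U. tensor_class R M N (frag_extend (\<lambda>(x, y). frag_of (f x, g y)) u))"

text \<open>For a ring \<open>A\<close> that is an \<open>R\<close>-algebra via \<open>\<phi>\<close>: the \<open>A\<close>-modules \<open>A \<otimes>\<^sub>R N\<close> and \<open>M \<otimes>\<^sub>R A\<close>.\<close>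

definition extend_scalars_left ::
  "('r, 'x) ring_scheme \<Rightarrow> ('r \<Rightarrow> 'a) \<Rightarrow> ('a, 'w) ring_scheme \<Rightarrow> ('r, 'n, 'z) module_scheme \<Rightarrow>
   ('a, (('a \<times> 'n) \<Rightarrow>\<^sub>0 int) set) module" where
  "extend_scalars_left R \<phi> A N =
     ring.extend (tensor_product R (restrict_scalars \<phi> A) N)
       (module.fields (\<lambda>a. tensor_map R (restrict_scalars \<phi> A) N (\<lambda>x. a \<otimes>\<^bsub>A\<^esub> x) id))"

definition extend_scalars_right ::
  "('r, 'x) ring_scheme \<Rightarrow> ('r, 'm, 'y) module_scheme \<Rightarrow> ('r \<Rightarrow> 'a) \<Rightarrow> ('a, 'w) ring_scheme \<Rightarrow>
   ('a, (('m \<times> 'a) \<Rightarrow>\<^sub>0 int) set) module" where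
  "extend_scalars_right R M \<phi> A =
     ring.extend (tensor_product R M (restrict_scalars \<phi> A))
       (module.fields (\<lambda>a. tensor_map R M (restrict_scalars \<phi> A) id (\<lambda>x. a \<otimes>\<^bsub>A\<^esub> x)))"


section \<open>Commutator submodules\<close>

definition submodule_generated ::
  "('r, 'x) ring_scheme \<Rightarrow> ('r, 'm, 'y) module_scheme \<Rightarrow> 'm set \<Rightarrow> 'm set" where
  "submodule_generated R M S = \<Inter>{N. submodule N R M \<and> S \<subseteq> N}"

definition graded_submodule ::
  "('g, 'w) monoid_scheme \<Rightarrow> ('g \<Rightarrow> 'm set) \<Rightarrow> ('r, 'x) ring_scheme \<Rightarrow> ('r, 'm, 'y) module_scheme \<Rightarrow>
   'm set \<Rightarrow> bool" where
  "graded_submodule \<Gamma> C R M N \<longleftrightarrow>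
     submodule N R M \<and>
     (\<forall>x\<in>N. \<exists>f. homogeneous_decomposition \<Gamma> (\<lambda>\<gamma>. N \<inter> C \<gamma>) M x f)"

definition graded_submodule_generated ::
  "('g, 'w) monoid_scheme \<Rightarrow> ('g \<Rightarrow> 'm set) \<Rightarrow> ('r, 'x) ring_scheme \<Rightarrow> ('r, 'm, 'y) module_scheme \<Rightarrow>
   'm set \<Rightarrow> 'm set" where
  "graded_submodule_generated \<Gamma> C R M S = \<Inter>{N. graded_submodule \<Gamma> C R M N \<and> S \<subseteq> N}"

definition commutators :: "('a, 'x) ring_scheme \<Rightarrow> 'a set \<Rightarrow> 'a set" where
  "commutators A S = {a \<otimes>\<^bsub>A\<^esub> b \<ominus>\<^bsub>A\<^esub> b \<otimes>\<^bsub>A\<^esub> a | a b. a \<in> S \<and> b \<in> S}"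

text \<open>\<open>D / [D, D]\<close> as an \<open>F\<close>-module.\<close>

definition graded_commutator_quotient ::
  "('g, 'z) monoid_scheme \<Rightarrow> ('g \<Rightarrow> 'd set) \<Rightarrow> ('d, 'y) ring_scheme \<Rightarrow> ('d, 'x) ring_scheme \<Rightarrow>
   ('d, 'd set) module" where
  "graded_commutator_quotient \<Gamma> C D F =
     quotient_module (restrict_scalars id D)
       (graded_submodule_generated \<Gamma> C F (restrict_scalars id D)
          (commutators D (homogeneous_elements \<Gamma> C)))"

text \<open>\<open>A / [A, A]\<close> as a \<open>K\<close>-module, for a \<open>K\<close>-algebra \<open>A\<close>.\<close>

definition commutator_quotient ::
  "('k, 'x) ring_scheme \<Rightarrow> ('k, 'a, 'y) module_scheme \<Rightarrow> ('k, 'a set) module" where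
  "commutator_quotient K A =
     quotient_module A (submodule_generated K A (commutators A (carrier A)))"

text \<open>\<open>QD = QF \<otimes>\<^sub>F D\<close> as a ring and \<open>QF\<close>-vector space.\<close>

definition quotient_division_ring ::
  "('d, 'x) ring_scheme \<Rightarrow> ('d, 'y) ring_scheme \<Rightarrow>
   (('d \<times> 'd) set, ((('d \<times> 'd) set \<times> 'd) \<Rightarrow>\<^sub>0 int) set) module" where
  "quotient_division_ring F D =
     extend_scalars_left F (to_quotient_field F) (quotient_field F) (restrict_scalars id D)"

definition vector_space_isomorphic ::
  "('k, 'x) ring_scheme \<Rightarrow> ('k, 'v, 'y) module_scheme \<Rightarrow> ('k, 'w, 'z) module_scheme \<Rightarrow> bool" where
  "vector_space_isomorphic K V W \<longleftrightarrow>
     field K \<and> module K V \<and> module K W \<and>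
     (\<exists>f \<in> iso (add_monoid V) (add_monoid W).
        \<forall>k\<in>carrier K. \<forall>v\<in>carrier V. f (k \<odot>\<^bsub>V\<^esub> v) = k \<odot>\<^bsub>W\<^esub> f v)"

end

theory Submission
  imports Defs
begin

text \<open>For any commutative \<open>F\<close>-algebra \<open>K\<close> the maps \<open>[d] \<otimes> k \<mapsto> [k \<otimes> d]\<close> and
  \<open>k \<otimes> d \<mapsto> [d] \<otimes> k\<close> between \<open>D/[D, D] \<otimes>\<^sub>F K\<close> and \<open>(K \<otimes>\<^sub>F D)/[K \<otimes>\<^sub>F D, K \<otimes>\<^sub>F D]\<close> are
  well defined, because \<open>k \<otimes> [a, b] = [k \<otimes> a, 1 \<otimes> b]\<close> and \<open>[k \<otimes> a, l \<otimes> b] = kl \<otimes> [a, b]\<close>, and they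
  are mutually inverse. The grading enters twice. The additive group generated by the homogeneous
  commutators is a graded \<open>F\<close>-submodule, since \<open>z [a, b] = [z a, b]\<close> for central \<open>z\<close>, so \<open>[D, D]\<close>
  is the \<open>F\<close>-span of all commutators. And since \<open>\<Gamma>\<close> is orderable, a product of non-zero elements of
  \<open>D\<close> has a non-zero leading component, so that \<open>F\<close> is a domain and \<open>QF\<close> a field.\<close>


section \<open>Tensor products\<close>

text \<open>The obstacle is well-definedness rather than algebra. Products, scalar multiples and
  \<open>tensor_map\<close> are unions over all representatives of a class, and such a union says
  nothing until every representative is known to contribute the same class. On tensor products each
  operation is therefore identified with a homomorphism obtained from the universal property, after
  which identities only have to be checked on pure tensors; for quotient modules and fractions the
  representatives are compared by hand. No inverse is built on \<open>W\<close>. The backward map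
  stays on \<open>K \<otimes> D\<close>: it is onto, it kills the commutator submodule, and the
  forward map after it is the projection. This already makes the forward map bijective and saves a
  second choice of representatives. The graded and the ungraded description of \<open>[D, D]\<close>
  are never compared directly. Both are shown equal to \<open>comm_span\<close>, a mere additive
  group, which lies in each of them for trivial reasons and turns out to be large enough.\<close>

lemma restrict_scalars_simps [simp]:
  "carrier (restrict_scalars \<phi> A) = carrier A"
  "monoid.mult (restrict_scalars \<phi> A) = monoid.mult A"
  "monoid.one (restrict_scalars \<phi> A) = monoid.one A"
  "ring.zero (restrict_scalars \<phi> A) = ring.zero A"
  "ring.add (restrict_scalars \<phi> A) = ring.add A"
  "r \<odot>\<^bsub>restrict_scalars \<phi> A\<^esub> a = \<phi> r \<otimes>\<^bsub>A\<^esub> a"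
  by (simp_all add: restrict_scalars_def ring.defs module.defs)

text \<open>The two records may differ in type and in all remaining fields; this moves the additive
  group of a ring to a module built on it.\<close>

lemma abelian_group_cong:
  assumes "carrier A = carrier B" "ring.add A = ring.add B" "ring.zero A = ring.zero B" "abelian_group B"
  shows "abelian_group A"
proof -
  interpret B: abelian_group B by fact
  show ?thesis
    by (rule abelian_groupI)
       (use assms B.l_neg B.a_inv_closed in \<open>auto simp: B.a_ac\<close>)
qed

lemma restrict_scalars_module:
  assumes "cring R" "ring A" "\<phi> \<in> ring_hom R A"
  shows "module R (restrict_scalars \<phi> A)"
proof -
  interpret R: cring R by fact
  interpret A: ring A by fact
  have "abelian_group (restrict_scalars \<phi> A)"
    by (rule abelian_group_cong[of _ A]) (auto intro: A.abelian_group_axioms)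
  then show ?thesis
    using assms(3)
    by (intro moduleI R.cring_axioms)
       (auto simp: ring_hom_closed ring_hom_add ring_hom_mult ring_hom_one A.l_distr A.r_distr A.m_assoc)
qed

text \<open>These are the maps for which \<open>f \<otimes> g\<close> respects the tensor relations.
  Multiplications by a fixed element will be the instances.\<close>

definition linear_endos :: "('r, 'x) ring_scheme \<Rightarrow> ('r, 'm, 'y) module_scheme \<Rightarrow> ('m \<Rightarrow> 'm) set" where
  "linear_endos R M = {f \<in> carrier M \<rightarrow> carrier M.
     (\<forall>x\<in>carrier M. \<forall>y\<in>carrier M. f (x \<oplus>\<^bsub>M\<^esub> y) = f x \<oplus>\<^bsub>M\<^esub> f y) \<and>
     (\<forall>r\<in>carrier R. \<forall>x\<in>carrier M. f (r \<odot>\<^bsub>M\<^esub> x) = r \<odot>\<^bsub>M\<^esub> f x)}"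

lemma id_linear_endo: "id \<in> linear_endos R M"
  by (simp add: linear_endos_def)

lemma tensor_product_simps:
  "carrier (tensor_product R M N) =
     carrier (free_Abelian_group (carrier M \<times> carrier N) Mod tensor_kernel R M N)"
  "ring.add (tensor_product R M N) =
     monoid.mult (free_Abelian_group (carrier M \<times> carrier N) Mod tensor_kernel R M N)"
  "ring.zero (tensor_product R M N) =
     monoid.one (free_Abelian_group (carrier M \<times> carrier N) Mod tensor_kernel R M N)"
  by (simp_all add: tensor_product_def Let_def)

text \<open>Keeping \<open>T\<close> abstract lets the facts below apply to the tensor product with any
  multiplication or scalar action on top of its additive group.\<close>

locale tensor =
  M: module R M + N: module R N
  for R :: "('r, 'x) ring_scheme"
    and M :: "('r, 'm, 'y) module_scheme" and N :: "('r, 'n, 'z) module_scheme" +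
  fixes T :: "((('m \<times> 'n) \<Rightarrow>\<^sub>0 int) set, 't) ring_scheme"
  assumes carrier_T: "carrier T = carrier (tensor_product R M N)"
    and add_T: "ring.add T = ring.add (tensor_product R M N)"
    and zero_T: "ring.zero T = ring.zero (tensor_product R M N)"
begin

abbreviation "frags \<equiv> free_Abelian_group (carrier M \<times> carrier N)"
abbreviation "kern \<equiv> tensor_kernel R M N"
abbreviation "cls \<equiv> tensor_class R M N"

definition pure :: "'m \<Rightarrow> 'n \<Rightarrow> (('m \<times> 'n) \<Rightarrow>\<^sub>0 int) set" where
  "pure x y = cls (frag_of (x, y))"

text \<open>Membership in \<open>frags\<close> would otherwise be unfolded to a condition on
  supports; the closure facts below let it stay opaque.\<close>

declare carrier_free_Abelian_group_iff [simp del]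

lemma frags_simps [simp]:
  "0 \<in> carrier frags"
  "u \<in> carrier frags \<Longrightarrow> v \<in> carrier frags \<Longrightarrow> u + v \<in> carrier frags"
  "u \<in> carrier frags \<Longrightarrow> v \<in> carrier frags \<Longrightarrow> u - v \<in> carrier frags"
  "u \<in> carrier frags \<Longrightarrow> - u \<in> carrier frags"
  "u \<in> carrier frags \<Longrightarrow> inv\<^bsub>frags\<^esub> u = - u"
  using keys_add[of u v] keys_diff[of u v] by (auto simp: carrier_free_Abelian_group_iff)

lemma relations_subset: "tensor_relations R M N \<subseteq> carrier frags"
  by (auto simp: tensor_relations_def)

lemma kern_subgroup: "subgroup kern frags"
  unfolding tensor_kernel_def
  by (rule group.generate_is_subgroup) (use relations_subset in auto)

lemma kern_normal: "kern \<lhd> frags"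
  by (simp add: comm_group.normal_iff_subgroup[OF abelian_free_Abelian_group] kern_subgroup)

lemma kern_frags: "u \<in> kern \<Longrightarrow> u \<in> carrier frags"
  by (rule subgroup.mem_carrier[OF kern_subgroup])

lemma kern_zero: "0 \<in> kern"
  using subgroup.one_closed[OF kern_subgroup] by simp

lemma kern_uminus: "u \<in> kern \<Longrightarrow> - u \<in> kern"
  using subgroup.m_inv_closed[OF kern_subgroup, of u] kern_frags[of u] by simp

lemma kern_add: "u \<in> kern \<Longrightarrow> v \<in> kern \<Longrightarrow> u + v \<in> kern"
  using subgroup.m_closed[OF kern_subgroup, of u v] by simp

lemma relations_kern: "tensor_relations R M N \<subseteq> kern"
  unfolding tensor_kernel_def by (auto intro: generate.incl)

lemma frags_induct [consumes 1, case_names zero diff of]: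
  assumes "u \<in> carrier frags" "P 0"
    "\<And>u v. u \<in> carrier frags \<Longrightarrow> v \<in> carrier frags \<Longrightarrow> P u \<Longrightarrow> P v \<Longrightarrow> P (u - v)"
    "\<And>x y. x \<in> carrier M \<Longrightarrow> y \<in> carrier N \<Longrightarrow> P (frag_of (x, y))"
  shows "P u"
  by (rule free_Abelian_group_induct[of u "carrier M \<times> carrier N"])
     (use assms in \<open>auto simp: carrier_free_Abelian_group_iff\<close>)

lemma abelian_group_T: "abelian_group T"
proof -
  interpret Q: comm_group "frags Mod kern"
    by (rule comm_group.abelian_FactGroup[OF abelian_free_Abelian_group kern_subgroup])
  show ?thesis
  proof (rule abelian_groupI)
    fix x assume "x \<in> carrier T"
    then show "\<exists>y\<in>carrier T. y \<oplus>\<^bsub>T\<^esub> x = \<zero>\<^bsub>T\<^esub>"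
      using Q.inv_closed[of x] Q.l_inv[of x]
      by (auto simp: carrier_T add_T zero_T tensor_product_simps simp del: mult_FactGroup one_FactGroup)
  qed (auto simp: carrier_T add_T zero_T tensor_product_simps Q.m_ac
       simp del: mult_FactGroup one_FactGroup)
qed

end

sublocale tensor \<subseteq> T: abelian_group T
  by (rule abelian_group_T)

context tensor
begin

lemma carrier_T_cls: "carrier T = cls ` carrier frags"
  by (auto simp: carrier_T tensor_product_simps tensor_class_def FactGroup_def RCOSETS_def)

lemma cls_closed: "u \<in> carrier frags \<Longrightarrow> cls u \<in> carrier T"
  by (simp only: carrier_T_cls imageI)

lemma cls_add:
  assumes "u \<in> carrier frags" "v \<in> carrier frags"
  shows "cls (u + v) = cls u \<oplus>\<^bsub>T\<^esub> cls v"
  using normal.rcos_sum[OF kern_normal assms]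
  by (simp add: add_T tensor_product_simps tensor_class_def FactGroup_def)

lemma cls_zero: "cls 0 = \<zero>\<^bsub>T\<^esub>"
proof -
  have "kern #>\<^bsub>frags\<^esub> \<one>\<^bsub>frags\<^esub> = kern"
    by (rule group.coset_mult_one) (use subgroup.subset[OF kern_subgroup] in auto)
  then show ?thesis
    by (simp add: zero_T tensor_product_simps tensor_class_def FactGroup_def)
qed

lemma cls_uminus:
  assumes "u \<in> carrier frags"
  shows "cls (- u) = \<ominus>\<^bsub>T\<^esub> cls u"
proof -
  have "cls (- u) \<oplus>\<^bsub>T\<^esub> cls u = \<zero>\<^bsub>T\<^esub>"
    using cls_add[of "- u" u] assms by (simp add: cls_zero)
  then show ?thesis
    using assms by (metis T.minus_equality cls_closed frags_simps(4))
qed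

lemma cls_diff:
  assumes "u \<in> carrier frags" "v \<in> carrier frags"
  shows "cls (u - v) = cls u \<ominus>\<^bsub>T\<^esub> cls v"
  using cls_add[of u "- v"] assms by (simp add: cls_uminus a_minus_def)

lemma cls_kern: "u \<in> kern \<Longrightarrow> cls u = \<zero>\<^bsub>T\<^esub>"
  using subgroup.rcos_const[OF kern_subgroup, of u]
  by (simp add: zero_T tensor_product_simps tensor_class_def FactGroup_def)

lemma cls_eqI:
  assumes "u - v \<in> kern" "u \<in> carrier frags" "v \<in> carrier frags"
  shows "cls u = cls v"
proof -
  have "cls u = cls ((u - v) + v)" by simp
  also have "\<dots> = \<zero>\<^bsub>T\<^esub> \<oplus>\<^bsub>T\<^esub> cls v"
    using assms kern_frags by (subst cls_add) (auto simp: cls_kern)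
  finally show ?thesis using assms(3) by (simp add: cls_closed)
qed

lemma cls_memD:
  assumes "u' \<in> cls u" "u \<in> carrier frags"
  shows "u' - u \<in> kern" "u' \<in> carrier frags"
  using assms kern_frags by (auto simp: tensor_class_def r_coset_def)

lemma cls_self: "u \<in> carrier frags \<Longrightarrow> u \<in> cls u"
  using kern_zero by (auto simp: tensor_class_def r_coset_def)

lemma pure_closed [simp]: "x \<in> carrier M \<Longrightarrow> y \<in> carrier N \<Longrightarrow> pure x y \<in> carrier T"
  by (auto simp: pure_def intro!: cls_closed)

lemma pure_add_left:
  assumes "x \<in> carrier M" "x' \<in> carrier M" "y \<in> carrier N"
  shows "pure (x \<oplus>\<^bsub>M\<^esub> x') y = pure x y \<oplus>\<^bsub>T\<^esub> pure x' y"
proof -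
  have "frag_of (x \<oplus>\<^bsub>M\<^esub> x', y) - frag_of (x, y) - frag_of (x', y) \<in> kern"
    using assms by (intro subsetD[OF relations_kern]) (auto simp: tensor_relations_def)
  then have "cls (frag_of (x \<oplus>\<^bsub>M\<^esub> x', y)) = cls (frag_of (x, y) + frag_of (x', y))"
    using assms by (intro cls_eqI) (auto simp: diff_diff_add)
  then show ?thesis
    using assms by (simp add: pure_def cls_add)
qed

lemma pure_add_right:
  assumes "x \<in> carrier M" "y \<in> carrier N" "y' \<in> carrier N"
  shows "pure x (y \<oplus>\<^bsub>N\<^esub> y') = pure x y \<oplus>\<^bsub>T\<^esub> pure x y'"
proof -
  have "frag_of (x, y \<oplus>\<^bsub>N\<^esub> y') - frag_of (x, y) - frag_of (x, y') \<in> kern"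
    using assms by (intro subsetD[OF relations_kern]) (auto simp: tensor_relations_def)
  then have "cls (frag_of (x, y \<oplus>\<^bsub>N\<^esub> y')) = cls (frag_of (x, y) + frag_of (x, y'))"
    using assms by (intro cls_eqI) (auto simp: diff_diff_add)
  then show ?thesis
    using assms by (simp add: pure_def cls_add)
qed

lemma pure_balanced:
  assumes "r \<in> carrier R" "x \<in> carrier M" "y \<in> carrier N"
  shows "pure (r \<odot>\<^bsub>M\<^esub> x) y = pure x (r \<odot>\<^bsub>N\<^esub> y)"
  unfolding pure_def
  using assms by (intro cls_eqI subsetD[OF relations_kern]) (auto simp: tensor_relations_def)

text \<open>Pure tensors generate the additive group, so two homomorphisms that agree on them are
  equal. Nearly every identity on a tensor product below is obtained in this way.\<close>

lemma tensor_induct [consumes 1, case_names zero add uminus pure]: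
  assumes "Z \<in> carrier T"
    and zero: "P (\<zero>\<^bsub>T\<^esub>)"
    and add: "\<And>Z Y. Z \<in> carrier T \<Longrightarrow> Y \<in> carrier T \<Longrightarrow> P Z \<Longrightarrow> P Y \<Longrightarrow> P (Z \<oplus>\<^bsub>T\<^esub> Y)"
    and uminus: "\<And>Z. Z \<in> carrier T \<Longrightarrow> P Z \<Longrightarrow> P (\<ominus>\<^bsub>T\<^esub> Z)"
    and pure: "\<And>x y. x \<in> carrier M \<Longrightarrow> y \<in> carrier N \<Longrightarrow> P (pure x y)"
  shows "P Z"
proof -
  obtain u where u: "u \<in> carrier frags" "Z = cls u"
    using assms(1) by (auto simp: carrier_T_cls)
  from u(1) have "P (cls u)"
  proof (induction rule: frags_induct)
    case (diff u v)
    then show ?case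
      by (simp add: cls_diff a_minus_def add uminus cls_closed)
  qed (auto simp: cls_zero zero pure[unfolded pure_def])
  then show ?thesis by (simp add: u)
qed

text \<open>The kernel is a generated subgroup, so a homomorphism on fragments vanishes on it once
  it vanishes on the three families of relations.\<close>

lemma kern_induct [consumes 1, case_names zero add uminus add_left add_right balanced]:
  assumes "u \<in> kern"
    and zero: "P 0"
    and add: "\<And>u v. u \<in> kern \<Longrightarrow> v \<in> kern \<Longrightarrow> P u \<Longrightarrow> P v \<Longrightarrow> P (u + v)"
    and uminus: "\<And>u. u \<in> kern \<Longrightarrow> P u \<Longrightarrow> P (- u)"
    and add_left: "\<And>x x' y. x \<in> carrier M \<Longrightarrow> x' \<in> carrier M \<Longrightarrow> y \<in> carrier N \<Longrightarrow>
      P (frag_of (x \<oplus>\<^bsub>M\<^esub> x', y) - frag_of (x, y) - frag_of (x', y))"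
    and add_right: "\<And>x y y'. x \<in> carrier M \<Longrightarrow> y \<in> carrier N \<Longrightarrow> y' \<in> carrier N \<Longrightarrow>
      P (frag_of (x, y \<oplus>\<^bsub>N\<^esub> y') - frag_of (x, y) - frag_of (x, y'))"
    and balanced: "\<And>r x y. r \<in> carrier R \<Longrightarrow> x \<in> carrier M \<Longrightarrow> y \<in> carrier N \<Longrightarrow>
      P (frag_of (r \<odot>\<^bsub>M\<^esub> x, y) - frag_of (x, r \<odot>\<^bsub>N\<^esub> y))"
  shows "P u"
proof -
  have rel: "P v" if "v \<in> tensor_relations R M N" for v
    using that add_left add_right balanced by (auto simp: tensor_relations_def)
  have "u \<in> generate frags (tensor_relations R M N)"
    using assms(1) by (simp add: tensor_kernel_def)
  then show ?thesis
  proof induction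
    case (inv h)
    then have "inv\<^bsub>frags\<^esub> h = - h" using relations_subset by auto
    then show ?case using inv uminus rel relations_kern by auto
  next
    case (eng h1 h2)
    then show ?case using add by (simp add: tensor_kernel_def)
  qed (use zero rel in auto)
qed

text \<open>The map extends to the free abelian group, biadditivity and balancedness say that the
  extension kills the relations, and so it factors through the quotient. The target is only an
  abelian group: linearity over the larger ring is always checked afterwards, on pure
  tensors.\<close>

lemma tensor_universal:
  assumes "abelian_group A"
    and closed: "\<And>x y. x \<in> carrier M \<Longrightarrow> y \<in> carrier N \<Longrightarrow> b x y \<in> carrier A"
    and add_left: "\<And>x x' y. x \<in> carrier M \<Longrightarrow> x' \<in> carrier M \<Longrightarrow> y \<in> carrier N \<Longrightarrow>
      b (x \<oplus>\<^bsub>M\<^esub> x') y = b x y \<oplus>\<^bsub>A\<^esub> b x' y"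
    and add_right: "\<And>x y y'. x \<in> carrier M \<Longrightarrow> y \<in> carrier N \<Longrightarrow> y' \<in> carrier N \<Longrightarrow>
      b x (y \<oplus>\<^bsub>N\<^esub> y') = b x y \<oplus>\<^bsub>A\<^esub> b x y'"
    and balanced: "\<And>r x y. r \<in> carrier R \<Longrightarrow> x \<in> carrier M \<Longrightarrow> y \<in> carrier N \<Longrightarrow>
      b (r \<odot>\<^bsub>M\<^esub> x) y = b x (r \<odot>\<^bsub>N\<^esub> y)"
  obtains h where "abelian_group_hom T A h"
    and "\<And>x y. x \<in> carrier M \<Longrightarrow> y \<in> carrier N \<Longrightarrow> h (pure x y) = b x y"
proof -
  interpret A: abelian_group A by fact
  have "comm_group (add_monoid A)" by (rule A.a_comm_group)
  moreover have "case_prod b ` (carrier M \<times> carrier N) \<subseteq> carrier (add_monoid A)"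
    using closed by auto
  ultimately obtain h0 where h0: "h0 \<in> hom frags (add_monoid A)"
    and h0_of: "\<And>p. p \<in> carrier M \<times> carrier N \<Longrightarrow> h0 (frag_of p) = case_prod b p"
    by (rule comm_group.free_Abelian_group_universal) blast
  interpret h0: group_hom frags "add_monoid A" h0
    by (intro group_hom.intro group_hom_axioms.intro h0 A.a_group) simp
  have h0_add: "h0 (u + v) = h0 u \<oplus>\<^bsub>A\<^esub> h0 v" if "u \<in> carrier frags" "v \<in> carrier frags" for u v
    using h0.hom_mult[of u v] that by simp
  have h0_uminus: "h0 (- u) = \<ominus>\<^bsub>A\<^esub> h0 u" if "u \<in> carrier frags" for u
    using h0.hom_inv[of u] that by (simp add: a_inv_def)
  have h0_diff: "h0 (u - v) = h0 u \<ominus>\<^bsub>A\<^esub> h0 v" if "u \<in> carrier frags" "v \<in> carrier frags" for u v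
    using h0_add[of u "- v"] h0_uminus[of v] that by (simp add: a_minus_def)
  have kern: "h0 u = \<zero>\<^bsub>A\<^esub>" if "u \<in> kern" for u
    using that
  proof (induction rule: kern_induct)
    case zero
    then show ?case using h0.hom_one by simp
  next
    case (add u v)
    then show ?case using kern_frags by (simp add: h0_add)
  next
    case (uminus u)
    then show ?case using kern_frags by (simp add: h0_uminus)
  next
    case (add_left x x' y)
    then show ?case
      by (simp add: h0_diff h0_of closed assms(3) a_minus_def A.minus_add A.a_assoc
           A.r_neg1 A.r_neg2 A.a_lcomm A.r_neg A.l_neg)
  next
    case (add_right x y y')
    then show ?case
      by (simp add: h0_diff h0_of closed assms(4) a_minus_def A.minus_add A.a_assoc
           A.r_neg1 A.r_neg2 A.a_lcomm A.r_neg A.l_neg)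
  next
    case (balanced r x y)
    then show ?case
      by (simp add: h0_diff h0_of closed assms(5) a_minus_def A.r_neg)
  qed
  have "kern \<subseteq> kernel frags (add_monoid A) h0"
    using kern subgroup.subset[OF kern_subgroup] by (auto simp: kernel_def)
  then obtain h where h: "h \<in> hom (frags Mod kern) (add_monoid A)"
    and h_cls: "\<And>u. u \<in> carrier frags \<Longrightarrow> h (kern #>\<^bsub>frags\<^esub> u) = h0 u"
    using h0.FactGroup_universal_kernel[OF kern_normal] by metis
  show thesis
  proof
    \<comment> \<open>\<open>T\<close> and the factor group have the same carrier and addition, so
      the factored map can be used for \<open>T\<close> as it is.\<close>
    have "h \<in> hom (add_monoid T) (add_monoid A)"
      using h by (simp add: hom_def carrier_T add_T tensor_product_simps)
    then show "abelian_group_hom T A h"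
      by (intro abelian_group_homI group_hom.intro group_hom_axioms.intro T.abelian_group_axioms
          A.abelian_group_axioms T.a_group A.a_group)
  next
    fix x y assume "x \<in> carrier M" "y \<in> carrier N"
    then show "h (pure x y) = b x y"
      by (simp add: pure_def tensor_class_def h_cls h0_of)
  qed
qed

end

text \<open>Maps defined as unions of classes agree with homomorphisms only on the carrier; this is
  enough to inherit additivity.\<close>

lemma abelian_group_hom_cong:
  assumes "abelian_group_hom A B h" "\<And>x. x \<in> carrier A \<Longrightarrow> h' x = h x"
  shows "abelian_group_hom A B h'"
proof -
  interpret abelian_group_hom A B h by fact
  have "h' \<in> hom (add_monoid A) (add_monoid B)"
    using assms(2) by (auto simp: hom_def)
  then show ?thesis
    by (intro abelian_group_homI group_hom.intro group_hom_axioms.intro G.abelian_group_axioms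
        H.abelian_group_axioms G.a_group H.a_group)
qed

lemma linear_endosD:
  assumes "f \<in> linear_endos R M"
  shows "x \<in> carrier M \<Longrightarrow> f x \<in> carrier M"
    and "x \<in> carrier M \<Longrightarrow> y \<in> carrier M \<Longrightarrow> f (x \<oplus>\<^bsub>M\<^esub> y) = f x \<oplus>\<^bsub>M\<^esub> f y"
    and "r \<in> carrier R \<Longrightarrow> x \<in> carrier M \<Longrightarrow> f (r \<odot>\<^bsub>M\<^esub> x) = r \<odot>\<^bsub>M\<^esub> f x"
  using assms by (auto simp: linear_endos_def)

text \<open>This is what makes the componentwise product on a tensor product well defined. Both
  sides are needed, since each factor of a product ranges over representatives.\<close>

definition bilinear_mult :: "('r, 'x) ring_scheme \<Rightarrow> ('r, 'm, 'y) module_scheme \<Rightarrow> bool" where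
  "bilinear_mult R M \<longleftrightarrow> (\<forall>a\<in>carrier M.
     (\<lambda>x. a \<otimes>\<^bsub>M\<^esub> x) \<in> linear_endos R M \<and> (\<lambda>x. x \<otimes>\<^bsub>M\<^esub> a) \<in> linear_endos R M)"

lemma bilinear_multD:
  assumes "bilinear_mult R M" "a \<in> carrier M"
  shows "(\<lambda>x. a \<otimes>\<^bsub>M\<^esub> x) \<in> linear_endos R M" "(\<lambda>x. x \<otimes>\<^bsub>M\<^esub> a) \<in> linear_endos R M"
  using assms by (auto simp: bilinear_mult_def)

text \<open>Right multiplications are linear by associativity alone; left multiplications have to
  move past \<open>\<phi> r\<close>, and there centrality enters.\<close>

lemma restrict_scalars_bilinear:
  assumes "ring A" "\<phi> \<in> carrier R \<rightarrow> carrier A"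
    and "\<And>r a. r \<in> carrier R \<Longrightarrow> a \<in> carrier A \<Longrightarrow> \<phi> r \<otimes>\<^bsub>A\<^esub> a = a \<otimes>\<^bsub>A\<^esub> \<phi> r"
  shows "bilinear_mult R (restrict_scalars \<phi> A)"
proof -
  interpret A: ring A by fact
  have [simp]: "r \<in> carrier R \<Longrightarrow> \<phi> r \<in> carrier A" for r
    using assms(2) by auto
  have "a \<otimes>\<^bsub>A\<^esub> (\<phi> r \<otimes>\<^bsub>A\<^esub> x) = \<phi> r \<otimes>\<^bsub>A\<^esub> (a \<otimes>\<^bsub>A\<^esub> x)"
    if "r \<in> carrier R" "a \<in> carrier A" "x \<in> carrier A" for r a x
    using that by (simp add: assms(3)[of r a] flip: A.m_assoc)
  then show ?thesis
    by (auto simp: bilinear_mult_def linear_endos_def A.l_distr A.r_distr A.m_assoc)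
qed

section \<open>Maps and products on tensor products\<close>

context tensor
begin

text \<open>This collapses the unions over representatives in \<open>tensor_map\<close> and in the
  product.\<close>

lemma cls_member_eq: "u' \<in> cls u \<Longrightarrow> u \<in> carrier frags \<Longrightarrow> cls u' = cls u"
  using cls_memD[of u' u] by (intro cls_eqI)

text \<open>The universal property supplies a map \<open>h\<close> that depends on the class only.
  On fragments the substitution \<open>?e\<close> lies over \<open>h\<close>, since both are
  additive and agree on generators; so all representatives of a class give the same result. The
  second claim covers arbitrary fragments because the inner sum of the tensor product multiplication
  is of this form.\<close>

lemma tensor_map_cls:
  assumes f: "f \<in> linear_endos R M" and g: "g \<in> linear_endos R N"
  shows "abelian_group_hom T T (tensor_map R M N f g)"
    and "u \<in> carrier frags \<Longrightarrow>
      tensor_map R M N f g (cls u) = cls (frag_extend (\<lambda>(x, y). frag_of (f x, g y)) u)"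
    and "x \<in> carrier M \<Longrightarrow> y \<in> carrier N \<Longrightarrow> tensor_map R M N f g (pure x y) = pure (f x) (g y)"
proof -
  let ?e = "frag_extend (\<lambda>(x, y). frag_of (f x, g y)) :: _ \<Rightarrow> ('m \<times> 'n) \<Rightarrow>\<^sub>0 int"
  note [simp] = linear_endosD[OF f] linear_endosD[OF g]
  obtain h where h: "abelian_group_hom T T h"
    and h_pure: "\<And>x y. x \<in> carrier M \<Longrightarrow> y \<in> carrier N \<Longrightarrow> h (pure x y) = pure (f x) (g y)"
    by (rule tensor_universal[of T "\<lambda>x y. pure (f x) (g y)"])
       (auto simp: T.abelian_group_axioms pure_add_left pure_add_right pure_balanced)
  interpret h: abelian_group_hom T T h by (rule h)
  have e_closed: "?e u \<in> carrier frags" if "u \<in> carrier frags" for u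
    using that by (induction rule: frags_induct) (auto simp: frag_extend_diff)
  have e: "cls (?e u) = h (cls u)" if "u \<in> carrier frags" for u
    using that
  proof (induction rule: frags_induct)
    case (diff u v)
    then show ?case
      by (simp add: frag_extend_diff cls_diff e_closed a_minus_def cls_closed)
  next
    case (of x y)
    then show ?case using h_pure[of x y] by (simp add: pure_def)
  qed (simp add: cls_zero)
  have tm: "tensor_map R M N f g (cls u) = h (cls u)" if u: "u \<in> carrier frags" for u
  proof -
    have "cls (?e u') = h (cls u)" if "u' \<in> cls u" for u'
      using e[of u'] cls_memD[OF that u] cls_member_eq[OF that u] by simp
    then show ?thesis
      using cls_self[OF u] by (auto simp: tensor_map_def)
  qed
  show "abelian_group_hom T T (tensor_map R M N f g)"
    by (rule abelian_group_hom_cong[OF h]) (auto simp: carrier_T_cls tm)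
  show "u \<in> carrier frags \<Longrightarrow> tensor_map R M N f g (cls u) = cls (?e u)"
    by (simp add: tm e)
  show "x \<in> carrier M \<Longrightarrow> y \<in> carrier N \<Longrightarrow> tensor_map R M N f g (pure x y) = pure (f x) (g y)"
    using tm[of "frag_of (x, y)"] h_pure[of x y] by (simp add: pure_def)
qed

text \<open>The two factors are treated one at a time. Left multiplication by a pure tensor is a
  \<open>tensor_map\<close>; for fixed \<open>V\<close> its value at \<open>V\<close> is biadditive
  and balanced in the entries of the pure tensor, so it extends to a homomorphism
  \<open>h V\<close>. The product of \<open>U\<close> and \<open>V\<close> is then
  \<open>h V U\<close>.\<close>

lemma tensor_mult:
  assumes mult_T: "monoid.mult T = monoid.mult (tensor_product R M N)"
    and bM: "bilinear_mult R M" and bN: "bilinear_mult R N"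
  shows "V \<in> carrier T \<Longrightarrow> abelian_group_hom T T (\<lambda>U. U \<otimes>\<^bsub>T\<^esub> V)"
    and "U \<in> carrier T \<Longrightarrow> abelian_group_hom T T (\<lambda>V. U \<otimes>\<^bsub>T\<^esub> V)"
    and "x \<in> carrier M \<Longrightarrow> y \<in> carrier N \<Longrightarrow> x' \<in> carrier M \<Longrightarrow> y' \<in> carrier N \<Longrightarrow>
      pure x y \<otimes>\<^bsub>T\<^esub> pure x' y' = pure (x \<otimes>\<^bsub>M\<^esub> x') (y \<otimes>\<^bsub>N\<^esub> y')"
proof -
  note lin = linear_endosD[OF bilinear_multD(1)[OF bM]] linear_endosD[OF bilinear_multD(2)[OF bM]]
    linear_endosD[OF bilinear_multD(1)[OF bN]] linear_endosD[OF bilinear_multD(2)[OF bN]]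
  \<comment> \<open>Left multiplication by the pure tensor of \<open>x\<close> and
    \<open>y\<close>.\<close>
  define L where "L x y = tensor_map R M N (\<lambda>x'. x \<otimes>\<^bsub>M\<^esub> x') (\<lambda>y'. y \<otimes>\<^bsub>N\<^esub> y')" for x y
  note L = tensor_map_cls[OF bilinear_multD(1)[OF bM] bilinear_multD(1)[OF bN], folded L_def]
  note L_hom = abelian_group_hom.hom_add[OF L(1)] abelian_group_hom.hom_zero[OF L(1)]
    abelian_group_hom.hom_a_inv[OF L(1)] abelian_group_hom.hom_closed[OF L(1)]
  have L_left: "L (x \<oplus>\<^bsub>M\<^esub> x') y V = L x y V \<oplus>\<^bsub>T\<^esub> L x' y V"
    if "x \<in> carrier M" "x' \<in> carrier M" "y \<in> carrier N" "V \<in> carrier T" for x x' y V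
    using that(4) that(1-3)
    by (induction rule: tensor_induct) (simp_all add: L_hom T.a_ac T.minus_add L(3) lin pure_add_left)
  have L_right: "L x (y \<oplus>\<^bsub>N\<^esub> y') V = L x y V \<oplus>\<^bsub>T\<^esub> L x y' V"
    if "x \<in> carrier M" "y \<in> carrier N" "y' \<in> carrier N" "V \<in> carrier T" for x y y' V
    using that(4) that(1-3)
    by (induction rule: tensor_induct) (simp_all add: L_hom T.a_ac T.minus_add L(3) lin pure_add_right)
  have L_bal: "L (r \<odot>\<^bsub>M\<^esub> x) y V = L x (r \<odot>\<^bsub>N\<^esub> y) V"
    if "r \<in> carrier R" "x \<in> carrier M" "y \<in> carrier N" "V \<in> carrier T" for r x y V
    using that(4) that(1-3)
    by (induction rule: tensor_induct) (simp_all add: L_hom L(3) lin pure_balanced)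
  have "\<exists>h. abelian_group_hom T T h \<and> (\<forall>x\<in>carrier M. \<forall>y\<in>carrier N. h (pure x y) = L x y V)"
    if V: "V \<in> carrier T" for V
    by (rule tensor_universal[of T "\<lambda>x y. L x y V"])
       (use V in \<open>auto simp: T.abelian_group_axioms L_left L_right L_bal L_hom\<close>)
  then obtain h where h: "\<And>V. V \<in> carrier T \<Longrightarrow> abelian_group_hom T T (h V)"
    and h_pure: "\<And>V x y. V \<in> carrier T \<Longrightarrow> x \<in> carrier M \<Longrightarrow> y \<in> carrier N \<Longrightarrow> h V (pure x y) = L x y V"
    by metis
  note h_hom = abelian_group_hom.hom_add[OF h] abelian_group_hom.hom_zero[OF h]
    abelian_group_hom.hom_a_inv[OF h] abelian_group_hom.hom_closed[OF h]
  \<comment> \<open>The double sum in the definition of the product, on representatives. Its class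
    will turn out to depend only on the classes of \<open>u\<close> and \<open>v\<close>.\<close>
  define m where "m u v = frag_extend (\<lambda>(x, y).
      frag_extend (\<lambda>(x', y'). frag_of (x \<otimes>\<^bsub>M\<^esub> x', y \<otimes>\<^bsub>N\<^esub> y')) v) u" for u v :: "('m \<times> 'n) \<Rightarrow>\<^sub>0 int"
  have inner_closed: "frag_extend (\<lambda>(x', y'). frag_of (x \<otimes>\<^bsub>M\<^esub> x', y \<otimes>\<^bsub>N\<^esub> y')) v \<in> carrier frags"
    if "v \<in> carrier frags" "x \<in> carrier M" "y \<in> carrier N" for x y v
    using that by (induction rule: frags_induct) (auto simp: frag_extend_diff lin)
  have m_closed: "m u v \<in> carrier frags" if "u \<in> carrier frags" "v \<in> carrier frags" for u v
    using that by (induction rule: frags_induct) (auto simp: m_def frag_extend_diff inner_closed)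
  have m: "cls (m u v) = h (cls v) (cls u)" if "u \<in> carrier frags" "v \<in> carrier frags" for u v
    using that
  proof (induction rule: frags_induct)
    case (diff u u')
    then have "m (u - u') v = m u v - m u' v" by (simp add: m_def frag_extend_diff)
    with diff show ?case
      by (simp add: cls_diff m_closed a_minus_def cls_closed h_hom)
  next
    case (of x y)
    then show ?case
      using h_pure[of "cls v" x y] L(2)[of x y v] by (simp add: pure_def cls_closed m_def)
  qed (simp add: cls_zero m_def h_hom cls_closed)
  have mult: "U \<otimes>\<^bsub>T\<^esub> V = h V U" if U: "U \<in> carrier T" and V: "V \<in> carrier T" for U V
  proof -
    obtain u v where uv: "u \<in> carrier frags" "U = cls u" "v \<in> carrier frags" "V = cls v"
      using U V by (auto simp: carrier_T_cls)
    have "cls (m u' v') = h V U" if "u' \<in> U" "v' \<in> V" for u' v'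
      using m[of u' v'] cls_memD[of u' u] cls_memD[of v' v] cls_member_eq[of u' u] cls_member_eq[of v' v] that uv
      by simp
    then have "(\<Union>u'\<in>U. \<Union>v'\<in>V. cls (m u' v')) = h V U"
      using cls_self[OF uv(1)] cls_self[OF uv(3)] uv by auto
    then show ?thesis
      by (simp add: mult_T tensor_product_def Let_def m_def)
  qed
  show "V \<in> carrier T \<Longrightarrow> abelian_group_hom T T (\<lambda>U. U \<otimes>\<^bsub>T\<^esub> V)"
    by (rule abelian_group_hom_cong[OF h]) (auto simp: mult)
  \<comment> \<open>Additivity in \<open>U\<close> holds by construction of \<open>h V\<close>.
    Additivity in \<open>V\<close> is a separate matter, reduced by induction on \<open>U\<close> to
    additivity of \<open>L x y\<close>.\<close>
  have h_add: "h (V \<oplus>\<^bsub>T\<^esub> V') U = h V U \<oplus>\<^bsub>T\<^esub> h V' U"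
    if "U \<in> carrier T" "V \<in> carrier T" "V' \<in> carrier T" for U V V'
    using that
    by (induction rule: tensor_induct) (simp_all add: h_hom T.a_ac T.minus_add h_pure L_hom)
  show "abelian_group_hom T T (\<lambda>V. U \<otimes>\<^bsub>T\<^esub> V)" if U: "U \<in> carrier T"
  proof -
    have "(\<lambda>V. U \<otimes>\<^bsub>T\<^esub> V) \<in> hom (add_monoid T) (add_monoid T)"
      using U by (auto simp: hom_def mult h_hom h_add)
    then show ?thesis
      by (intro abelian_group_homI group_hom.intro group_hom_axioms.intro T.abelian_group_axioms T.a_group)
  qed
  show "x \<in> carrier M \<Longrightarrow> y \<in> carrier N \<Longrightarrow> x' \<in> carrier M \<Longrightarrow> y' \<in> carrier N \<Longrightarrow>
      pure x y \<otimes>\<^bsub>T\<^esub> pure x' y' = pure (x \<otimes>\<^bsub>M\<^esub> x') (y \<otimes>\<^bsub>N\<^esub> y')"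
    by (simp add: mult h_pure L(3))
qed

end

section \<open>Extension of scalars\<close>

text \<open>If each scalar acts additively, the other module axioms are identities between
  homomorphisms, so pure tensors suffice. The lemma stands outside the locale because there
  \<open>T\<close> is an arbitrary extension of a ring record and has no scalar action to speak
  of.\<close>

lemma tensor_moduleI:
  fixes V :: "('k, (('m \<times> 'n) \<Rightarrow>\<^sub>0 int) set, 't) module_scheme"
  assumes "tensor R M N V" "cring K"
    and hom: "\<And>k. k \<in> carrier K \<Longrightarrow> abelian_group_hom V V (\<lambda>v. k \<odot>\<^bsub>V\<^esub> v)"
    and add: "\<And>k l x y. k \<in> carrier K \<Longrightarrow> l \<in> carrier K \<Longrightarrow> x \<in> carrier M \<Longrightarrow> y \<in> carrier N \<Longrightarrow>
      (k \<oplus>\<^bsub>K\<^esub> l) \<odot>\<^bsub>V\<^esub> tensor.pure R M N x y =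
      k \<odot>\<^bsub>V\<^esub> tensor.pure R M N x y \<oplus>\<^bsub>V\<^esub> l \<odot>\<^bsub>V\<^esub> tensor.pure R M N x y"
    and mult: "\<And>k l x y. k \<in> carrier K \<Longrightarrow> l \<in> carrier K \<Longrightarrow> x \<in> carrier M \<Longrightarrow> y \<in> carrier N \<Longrightarrow>
      (k \<otimes>\<^bsub>K\<^esub> l) \<odot>\<^bsub>V\<^esub> tensor.pure R M N x y = k \<odot>\<^bsub>V\<^esub> (l \<odot>\<^bsub>V\<^esub> tensor.pure R M N x y)"
    and one: "\<And>x y. x \<in> carrier M \<Longrightarrow> y \<in> carrier N \<Longrightarrow>
      \<one>\<^bsub>K\<^esub> \<odot>\<^bsub>V\<^esub> tensor.pure R M N x y = tensor.pure R M N x y"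
  shows "module K V"
proof -
  interpret tensor R M N V by fact
  interpret K: cring K by fact
  note h = abelian_group_hom.hom_add[OF hom] abelian_group_hom.hom_zero[OF hom]
    abelian_group_hom.hom_a_inv[OF hom] abelian_group_hom.hom_closed[OF hom]
  show ?thesis
  proof (rule moduleI[OF \<open>cring K\<close> T.abelian_group_axioms])
    fix a b x assume ab: "a \<in> carrier K" "b \<in> carrier K" and x: "x \<in> carrier V"
    from x ab show "(a \<oplus>\<^bsub>K\<^esub> b) \<odot>\<^bsub>V\<^esub> x = a \<odot>\<^bsub>V\<^esub> x \<oplus>\<^bsub>V\<^esub> b \<odot>\<^bsub>V\<^esub> x"
      by (induction rule: tensor_induct) (simp_all add: h add T.a_ac T.minus_add)
    from x ab show "(a \<otimes>\<^bsub>K\<^esub> b) \<odot>\<^bsub>V\<^esub> x = a \<odot>\<^bsub>V\<^esub> (b \<odot>\<^bsub>V\<^esub> x)"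
      by (induction rule: tensor_induct) (simp_all add: h mult)
  next
    fix x assume "x \<in> carrier V"
    then show "\<one>\<^bsub>K\<^esub> \<odot>\<^bsub>V\<^esub> x = x"
      by (induction rule: tensor_induct) (simp_all add: h one)
  qed (simp_all add: h)
qed

lemma extend_scalars_left_simps:
  "carrier (extend_scalars_left R \<phi> A N) = carrier (tensor_product R (restrict_scalars \<phi> A) N)"
  "ring.add (extend_scalars_left R \<phi> A N) = ring.add (tensor_product R (restrict_scalars \<phi> A) N)"
  "ring.zero (extend_scalars_left R \<phi> A N) = ring.zero (tensor_product R (restrict_scalars \<phi> A) N)"
  "monoid.mult (extend_scalars_left R \<phi> A N) = monoid.mult (tensor_product R (restrict_scalars \<phi> A) N)"
  "smult (extend_scalars_left R \<phi> A N) =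
     (\<lambda>a. tensor_map R (restrict_scalars \<phi> A) N (\<lambda>x. a \<otimes>\<^bsub>A\<^esub> x) id)"
  by (simp_all add: extend_scalars_left_def ring.defs module.defs)

lemma extend_scalars_right_simps:
  "carrier (extend_scalars_right R M \<phi> A) = carrier (tensor_product R M (restrict_scalars \<phi> A))"
  "ring.add (extend_scalars_right R M \<phi> A) = ring.add (tensor_product R M (restrict_scalars \<phi> A))"
  "ring.zero (extend_scalars_right R M \<phi> A) = ring.zero (tensor_product R M (restrict_scalars \<phi> A))"
  "smult (extend_scalars_right R M \<phi> A) =
     (\<lambda>a. tensor_map R M (restrict_scalars \<phi> A) id (\<lambda>x. a \<otimes>\<^bsub>A\<^esub> x))"
  by (simp_all add: extend_scalars_right_def ring.defs module.defs)

lemma extend_scalars_left: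
  assumes "cring R" "cring A" "\<phi> \<in> ring_hom R A" "module R N"
  shows "tensor R (restrict_scalars \<phi> A) N (extend_scalars_left R \<phi> A N)"
    and "module A (extend_scalars_left R \<phi> A N)"
    and "\<And>a x y. a \<in> carrier A \<Longrightarrow> x \<in> carrier A \<Longrightarrow> y \<in> carrier N \<Longrightarrow>
      a \<odot>\<^bsub>extend_scalars_left R \<phi> A N\<^esub> tensor.pure R (restrict_scalars \<phi> A) N x y =
      tensor.pure R (restrict_scalars \<phi> A) N (a \<otimes>\<^bsub>A\<^esub> x) y"
proof -
  interpret A: cring A by fact
  let ?M = "restrict_scalars \<phi> A" and ?V = "extend_scalars_left R \<phi> A N"
  show T: "tensor R ?M N ?V"
    by (intro tensor.intro tensor_axioms.intro restrict_scalars_module assms A.ring_axioms)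
       (simp_all add: extend_scalars_left_simps)
  interpret tensor R ?M N ?V by fact
  have b: "bilinear_mult R ?M"
    using assms(3) by (intro restrict_scalars_bilinear A.ring_axioms)
      (auto simp: ring_hom_closed intro: A.m_comm)
  have lin: "(\<lambda>x. a \<otimes>\<^bsub>A\<^esub> x) \<in> linear_endos R ?M" if "a \<in> carrier A" for a
    using bilinear_multD(1)[OF b, of a] that by simp
  note tm = tensor_map_cls[OF lin id_linear_endo]
  show sm: "a \<odot>\<^bsub>?V\<^esub> pure x y = pure (a \<otimes>\<^bsub>A\<^esub> x) y"
    if "a \<in> carrier A" "x \<in> carrier A" "y \<in> carrier N" for a x y
    using tm(3)[of a x y] that by (simp add: extend_scalars_left_simps)
  show "module A ?V"
    using T assms(2)
  proof (rule tensor_moduleI)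
    fix k l x y
    assume kl: "k \<in> carrier A" "l \<in> carrier A" and xy: "x \<in> carrier ?M" "y \<in> carrier N"
    show "(k \<oplus>\<^bsub>A\<^esub> l) \<odot>\<^bsub>?V\<^esub> pure x y = k \<odot>\<^bsub>?V\<^esub> pure x y \<oplus>\<^bsub>?V\<^esub> l \<odot>\<^bsub>?V\<^esub> pure x y"
      using kl xy pure_add_left[of "k \<otimes>\<^bsub>A\<^esub> x" "l \<otimes>\<^bsub>A\<^esub> x" y] by (simp add: sm A.l_distr)
    show "(k \<otimes>\<^bsub>A\<^esub> l) \<odot>\<^bsub>?V\<^esub> pure x y = k \<odot>\<^bsub>?V\<^esub> (l \<odot>\<^bsub>?V\<^esub> pure x y)"
      using kl xy by (simp add: sm A.m_assoc)
  next
    show "\<And>k. k \<in> carrier A \<Longrightarrow> abelian_group_hom ?V ?V ((\<odot>\<^bsub>?V\<^esub>) k)"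
      using tm(1) by (simp add: extend_scalars_left_simps)
  qed (simp add: sm)
qed

lemma extend_scalars_right:
  assumes "cring R" "cring A" "\<phi> \<in> ring_hom R A" "module R M"
  shows "tensor R M (restrict_scalars \<phi> A) (extend_scalars_right R M \<phi> A)"
    and "module A (extend_scalars_right R M \<phi> A)"
    and "\<And>a x y. a \<in> carrier A \<Longrightarrow> x \<in> carrier M \<Longrightarrow> y \<in> carrier A \<Longrightarrow>
      a \<odot>\<^bsub>extend_scalars_right R M \<phi> A\<^esub> tensor.pure R M (restrict_scalars \<phi> A) x y =
      tensor.pure R M (restrict_scalars \<phi> A) x (a \<otimes>\<^bsub>A\<^esub> y)"
proof -
  interpret A: cring A by fact
  let ?N = "restrict_scalars \<phi> A" and ?V = "extend_scalars_right R M \<phi> A"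
  show T: "tensor R M ?N ?V"
    by (intro tensor.intro tensor_axioms.intro restrict_scalars_module assms A.ring_axioms)
       (simp_all add: extend_scalars_right_simps)
  interpret tensor R M ?N ?V by fact
  have b: "bilinear_mult R ?N"
    using assms(3) by (intro restrict_scalars_bilinear A.ring_axioms)
      (auto simp: ring_hom_closed intro: A.m_comm)
  have lin: "(\<lambda>x. a \<otimes>\<^bsub>A\<^esub> x) \<in> linear_endos R ?N" if "a \<in> carrier A" for a
    using bilinear_multD(1)[OF b, of a] that by simp
  note tm = tensor_map_cls[OF id_linear_endo lin]
  show sm: "a \<odot>\<^bsub>?V\<^esub> pure x y = pure x (a \<otimes>\<^bsub>A\<^esub> y)"
    if "a \<in> carrier A" "x \<in> carrier M" "y \<in> carrier A" for a x y
    using tm(3)[of a x y] that by (simp add: extend_scalars_right_simps)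
  show "module A ?V"
    using T assms(2)
  proof (rule tensor_moduleI)
    fix k l x y
    assume kl: "k \<in> carrier A" "l \<in> carrier A" and xy: "x \<in> carrier M" "y \<in> carrier ?N"
    show "(k \<oplus>\<^bsub>A\<^esub> l) \<odot>\<^bsub>?V\<^esub> pure x y = k \<odot>\<^bsub>?V\<^esub> pure x y \<oplus>\<^bsub>?V\<^esub> l \<odot>\<^bsub>?V\<^esub> pure x y"
      using kl xy pure_add_right[of x "k \<otimes>\<^bsub>A\<^esub> y" "l \<otimes>\<^bsub>A\<^esub> y"] by (simp add: sm A.l_distr)
    show "(k \<otimes>\<^bsub>A\<^esub> l) \<odot>\<^bsub>?V\<^esub> pure x y = k \<odot>\<^bsub>?V\<^esub> (l \<odot>\<^bsub>?V\<^esub> pure x y)"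
      using kl xy by (simp add: sm A.m_assoc)
  next
    show "\<And>k. k \<in> carrier A \<Longrightarrow> abelian_group_hom ?V ?V ((\<odot>\<^bsub>?V\<^esub>) k)"
      using tm(1) by (simp add: extend_scalars_right_simps)
  qed (simp add: sm)
qed


section \<open>Quotient modules and base change\<close>

lemma quotient_module_simps:
  "carrier (quotient_module M N) = a_rcosets\<^bsub>M\<^esub> N"
  "ring.add (quotient_module M N) = set_add M"
  "ring.zero (quotient_module M N) = N"
  "smult (quotient_module M N) = (\<lambda>r U. \<Union>x\<in>U. N +>\<^bsub>M\<^esub> (r \<odot>\<^bsub>M\<^esub> x))"
  by (simp_all add: quotient_module_def FactRing_def ring.defs module.defs)

lemma quotient_module:
  assumes "module R M" "submodule N R M"
  shows "module R (quotient_module M N)"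
    and "abelian_group_hom M (quotient_module M N) (\<lambda>x. N +>\<^bsub>M\<^esub> x)"
    and "carrier (quotient_module M N) = (\<lambda>x. N +>\<^bsub>M\<^esub> x) ` carrier M"
    and "\<And>x. x \<in> carrier M \<Longrightarrow> N +>\<^bsub>M\<^esub> x = \<zero>\<^bsub>quotient_module M N\<^esub> \<longleftrightarrow> x \<in> N"
    and "\<And>r x. r \<in> carrier R \<Longrightarrow> x \<in> carrier M \<Longrightarrow>
      r \<odot>\<^bsub>quotient_module M N\<^esub> (N +>\<^bsub>M\<^esub> x) = N +>\<^bsub>M\<^esub> (r \<odot>\<^bsub>M\<^esub> x)"
proof -
  interpret M: module R M by fact
  interpret N: submodule N R M by fact
  let ?Q = "quotient_module M N" and ?q = "\<lambda>x. N +>\<^bsub>M\<^esub> x"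
  interpret A: abelian_subgroup N M
    by (intro abelian_subgroupI3 additive_subgroupI N.subgroup_axioms M.abelian_group_axioms)
  interpret F: comm_group "M A_Mod N" by (rule A.a_factorgroup_is_comm_group)
  have F_simps: "carrier (M A_Mod N) = carrier ?Q" "monoid.mult (M A_Mod N) = ring.add ?Q"
    "monoid.one (M A_Mod N) = ring.zero ?Q"
    by (simp_all add: A_FactGroup_def' quotient_module_simps)
  have Q: "abelian_group ?Q"
  proof (rule abelian_groupI)
    fix x assume "x \<in> carrier ?Q"
    then show "\<exists>y\<in>carrier ?Q. y \<oplus>\<^bsub>?Q\<^esub> x = \<zero>\<^bsub>?Q\<^esub>"
      using F.l_inv_ex[of x] unfolding F_simps by simp
  qed (use F.m_closed F.one_closed F.m_assoc F.m_comm F.l_one in \<open>simp_all add: F_simps\<close>)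
  interpret Q: abelian_group ?Q by (rule Q)
  show q: "abelian_group_hom M ?Q ?q"
  proof (intro abelian_group_homI group_hom.intro group_hom_axioms.intro M.abelian_group_axioms Q
      M.a_group Q.a_group)
    show "?q \<in> hom (add_monoid M) (add_monoid ?Q)"
      using A.a_r_coset_hom_A_Mod by (simp add: hom_def F_simps)
  qed
  interpret q: abelian_group_hom M ?Q ?q by (rule q)
  show car: "carrier ?Q = ?q ` carrier M"
    by (auto simp: quotient_module_simps A_RCOSETS_def')
  show "?q x = \<zero>\<^bsub>?Q\<^esub> \<longleftrightarrow> x \<in> N" if "x \<in> carrier M" for x
    using that A.a_rcos_self[of x] A.a_rcos_const[of x] by (auto simp: quotient_module_simps)
  show sm: "r \<odot>\<^bsub>?Q\<^esub> (?q x) = ?q (r \<odot>\<^bsub>M\<^esub> x)" if r: "r \<in> carrier R" and x: "x \<in> carrier M" for r x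
  proof -
    \<comment> \<open>Two representatives differ by an element of \<open>N\<close>, and its multiple
      by \<open>r\<close> stays in \<open>N\<close>. The union in the scalar action therefore runs
      over equal sets, and its index set is non-empty as it contains \<open>x\<close>.\<close>
    have "?q (r \<odot>\<^bsub>M\<^esub> y) = ?q (r \<odot>\<^bsub>M\<^esub> x)" if y: "y \<in> ?q x" for y
    proof -
      obtain n where n: "n \<in> N" "y = n \<oplus>\<^bsub>M\<^esub> x"
        using y by (auto simp: a_r_coset_def')
      then have "r \<odot>\<^bsub>M\<^esub> y = r \<odot>\<^bsub>M\<^esub> n \<oplus>\<^bsub>M\<^esub> r \<odot>\<^bsub>M\<^esub> x"
        using r x by (simp add: M.smult_r_distr)
      moreover have "?q (r \<odot>\<^bsub>M\<^esub> n) = \<zero>\<^bsub>?Q\<^esub>"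
        using n r by (simp add: A.a_rcos_const quotient_module_simps N.smult_closed)
      ultimately show ?thesis
        using r x n by simp
    qed
    then have "(\<Union>y\<in>?q x. ?q (r \<odot>\<^bsub>M\<^esub> y)) = (\<Union>y\<in>?q x. ?q (r \<odot>\<^bsub>M\<^esub> x))"
      by (intro SUP_cong refl)
    then show ?thesis
      using A.a_rcos_self[OF x] by (simp add: quotient_module_simps) blast
  qed
  show "module R ?Q"
  proof (rule moduleI[OF M.is_cring Q])
    fix a b x y assume *: "a \<in> carrier R" "b \<in> carrier R" "x \<in> carrier ?Q" "y \<in> carrier ?Q"
    then obtain x' y' where xy: "x' \<in> carrier M" "x = ?q x'" "y' \<in> carrier M" "y = ?q y'"
      unfolding car by auto
    show "a \<odot>\<^bsub>?Q\<^esub> (x \<oplus>\<^bsub>?Q\<^esub> y) = a \<odot>\<^bsub>?Q\<^esub> x \<oplus>\<^bsub>?Q\<^esub> a \<odot>\<^bsub>?Q\<^esub> y"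
      using * xy by (simp add: sm M.smult_r_distr flip: q.hom_add)
  next
    fix a b x assume *: "a \<in> carrier R" "b \<in> carrier R" "x \<in> carrier ?Q"
    then obtain x' where x: "x' \<in> carrier M" "x = ?q x'"
      unfolding car by auto
    show "(a \<oplus>\<^bsub>R\<^esub> b) \<odot>\<^bsub>?Q\<^esub> x = a \<odot>\<^bsub>?Q\<^esub> x \<oplus>\<^bsub>?Q\<^esub> b \<odot>\<^bsub>?Q\<^esub> x"
      using * x by (simp add: sm M.smult_l_distr)
    show "(a \<otimes>\<^bsub>R\<^esub> b) \<odot>\<^bsub>?Q\<^esub> x = a \<odot>\<^bsub>?Q\<^esub> (b \<odot>\<^bsub>?Q\<^esub> x)"
      using * x by (simp add: sm M.smult_assoc1)
  qed (auto simp: car sm)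
qed

lemma submodule_generated:
  assumes "module R M" "S \<subseteq> carrier M"
  shows "submodule (submodule_generated R M S) R M"
    and "S \<subseteq> submodule_generated R M S"
    and "\<And>N. submodule N R M \<Longrightarrow> S \<subseteq> N \<Longrightarrow> submodule_generated R M S \<subseteq> N"
proof -
  interpret M: module R M by fact
  show "submodule (submodule_generated R M S) R M"
  proof (rule M.submoduleI)
    show "submodule_generated R M S \<subseteq> carrier M"
      \<comment> \<open>The whole module is a member of the family, which keeps the intersection
        inside the carrier.\<close>
      using assms(2) M.carrier_is_submodule by (auto simp: submodule_generated_def)
    show "\<zero>\<^bsub>M\<^esub> \<in> submodule_generated R M S"
      using subgroup.one_closed[OF submodule.axioms(1)] by (fastforce simp: submodule_generated_def)
  qed (use M.submoduleE in \<open>auto simp: submodule_generated_def\<close>)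
qed (auto simp: submodule_generated_def)

section \<open>Base change of the commutator quotient\<close>

text \<open>The setting without grading: \<open>K\<close> is a commutative and \<open>D\<close> an
  arbitrary \<open>R\<close>-algebra, and \<open>QD\<close> stands for \<open>K \<otimes> D\<close>.
  \<open>V\<close> and \<open>W\<close> are the two sides of the isomorphism. Centrality of the
  image of \<open>\<psi>\<close> is what makes \<open>QD\<close> a ring.\<close>

locale central_base_change =
  R: cring R + K: cring K + D: ring D
  for R :: "('r, 'x) ring_scheme" and K :: "('k, 'w) ring_scheme" and D :: "('d, 'y) ring_scheme" +
  fixes \<phi> :: "'r \<Rightarrow> 'k" and \<psi> :: "'r \<Rightarrow> 'd"
  assumes \<phi>: "\<phi> \<in> ring_hom R K" and \<psi>: "\<psi> \<in> ring_hom R D"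
    and central: "r \<in> carrier R \<Longrightarrow> d \<in> carrier D \<Longrightarrow> \<psi> r \<otimes>\<^bsub>D\<^esub> d = d \<otimes>\<^bsub>D\<^esub> \<psi> r"
begin

abbreviation "MD \<equiv> restrict_scalars \<psi> D"
abbreviation "MK \<equiv> restrict_scalars \<phi> K"
definition "QD = extend_scalars_left R \<phi> K MD"
definition "ND = submodule_generated R MD (commutators D (carrier D))"
definition "NQ = submodule_generated K QD (commutators QD (carrier QD))"
abbreviation "DN \<equiv> quotient_module MD ND"
definition "V = extend_scalars_right R DN \<phi> K"
abbreviation "W \<equiv> quotient_module QD NQ"

lemma MD_module: "module R MD"
  by (intro restrict_scalars_module R.is_cring D.ring_axioms \<psi>)

lemma commutators_D: "commutators D (carrier D) \<subseteq> carrier MD"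
  by (auto simp: commutators_def)

lemmas ND = submodule_generated[OF MD_module commutators_D, folded ND_def]
lemmas DN = quotient_module[OF MD_module ND(1)]
lemmas QD = extend_scalars_left[OF R.is_cring K.is_cring \<phi> MD_module, folded QD_def]
lemmas V = extend_scalars_right[OF R.is_cring K.is_cring \<phi> DN(1), folded V_def]

sublocale QD: tensor R MK MD QD by (rule QD(1))
sublocale QDm: module K QD by (rule QD(2))
sublocale V: tensor R DN MK V by (rule V(1))
sublocale Vm: module K V by (rule V(2))

abbreviation "pq \<equiv> QD.pure"
abbreviation "pv \<equiv> V.pure"
abbreviation "qD d \<equiv> ND +>\<^bsub>MD\<^esub> d"
abbreviation "qW u \<equiv> NQ +>\<^bsub>QD\<^esub> u"

lemma QD_mult:
  shows "v \<in> carrier QD \<Longrightarrow> abelian_group_hom QD QD (\<lambda>u. u \<otimes>\<^bsub>QD\<^esub> v)"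
    and "u \<in> carrier QD \<Longrightarrow> abelian_group_hom QD QD (\<lambda>v. u \<otimes>\<^bsub>QD\<^esub> v)"
    and "k \<in> carrier K \<Longrightarrow> d \<in> carrier D \<Longrightarrow> k' \<in> carrier K \<Longrightarrow> d' \<in> carrier D \<Longrightarrow>
      pq k d \<otimes>\<^bsub>QD\<^esub> pq k' d' = pq (k \<otimes>\<^bsub>K\<^esub> k') (d \<otimes>\<^bsub>D\<^esub> d')"
proof -
  have bK: "bilinear_mult R MK"
    using \<phi> by (intro restrict_scalars_bilinear K.ring_axioms)
      (auto simp: ring_hom_closed intro: K.m_comm)
  have bD: "bilinear_mult R MD"
    using \<psi> by (intro restrict_scalars_bilinear D.ring_axioms)
      (auto simp: ring_hom_closed central)
  have m: "monoid.mult QD = monoid.mult (tensor_product R MK MD)"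
    by (simp add: QD_def extend_scalars_left_simps)
  note * = QD.tensor_mult[OF m bK bD]
  show "v \<in> carrier QD \<Longrightarrow> abelian_group_hom QD QD (\<lambda>u. u \<otimes>\<^bsub>QD\<^esub> v)"
    and "u \<in> carrier QD \<Longrightarrow> abelian_group_hom QD QD (\<lambda>v. u \<otimes>\<^bsub>QD\<^esub> v)"
    by (fact *)+
  show "k \<in> carrier K \<Longrightarrow> d \<in> carrier D \<Longrightarrow> k' \<in> carrier K \<Longrightarrow> d' \<in> carrier D \<Longrightarrow>
      pq k d \<otimes>\<^bsub>QD\<^esub> pq k' d' = pq (k \<otimes>\<^bsub>K\<^esub> k') (d \<otimes>\<^bsub>D\<^esub> d')"
    using *(3) by simp
qed

lemmas QD_mult_simps =
  abelian_group_hom.hom_add[OF QD_mult(1)] abelian_group_hom.hom_zero[OF QD_mult(1)]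
  abelian_group_hom.hom_a_inv[OF QD_mult(1)] abelian_group_hom.hom_closed[OF QD_mult(1)]
  abelian_group_hom.hom_add[OF QD_mult(2)] abelian_group_hom.hom_zero[OF QD_mult(2)]
  abelian_group_hom.hom_a_inv[OF QD_mult(2)]

lemma commutators_QD: "commutators QD (carrier QD) \<subseteq> carrier QD"
  by (auto simp: commutators_def a_minus_def QD_mult_simps)

lemmas NQ = submodule_generated[OF QD(2) commutators_QD, folded NQ_def]
lemmas W = quotient_module[OF QD(2) NQ(1)]

sublocale W: abelian_group W by (rule abelian_group_hom.axioms(2)[OF W(2)])
sublocale Wm: module K W by (rule W(1))
sublocale qD: abelian_group_hom MD DN "\<lambda>d. qD d" by (rule DN(2))
sublocale qW: abelian_group_hom QD W "\<lambda>u. qW u" by (rule W(2))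

lemma pq_left_hom: "k \<in> carrier K \<Longrightarrow> abelian_group_hom MD QD (\<lambda>d. pq k d)"
  by (intro abelian_group_homI group_hom.intro group_hom_axioms.intro QD.N.abelian_group_axioms
        QD.T.abelian_group_axioms QD.N.a_group QD.T.a_group)
     (use QD.pure_add_right[of k] in \<open>simp_all add: hom_def\<close>)

text \<open>The elements \<open>d\<close> for which every \<open>k \<otimes> d\<close> lies in
  \<open>NQ\<close> form a submodule containing all commutators. The quantifier over
  \<open>k\<close> has to be part of the set: closure under scalars rewrites
  \<open>k \<otimes> r d\<close> as \<open>r k \<otimes> d\<close>, which changes the left
  factor.\<close>

lemma pq_ND:
  assumes "d \<in> ND" "k \<in> carrier K"
  shows "pq k d \<in> NQ"
proof -
  interpret NQ: submodule NQ K QD by (rule NQ(1))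
  let ?S = "{d \<in> carrier D. \<forall>k\<in>carrier K. pq k d \<in> NQ}"
  have "submodule ?S R MD"
  proof (rule QD.N.submoduleI)
    show "\<zero>\<^bsub>MD\<^esub> \<in> ?S"
      using abelian_group_hom.hom_zero[OF pq_left_hom] NQ.one_closed by simp
  next
    fix a assume "a \<in> ?S"
    then show "\<ominus>\<^bsub>MD\<^esub> a \<in> ?S"
      using abelian_group_hom.hom_a_inv[OF pq_left_hom, of _ a] QDm.submoduleE(3)[OF NQ(1)]
        QD.N.a_inv_closed[of a] by simp
  next
    fix a b assume "a \<in> ?S" "b \<in> ?S"
    then show "a \<oplus>\<^bsub>MD\<^esub> b \<in> ?S"
      using QD.pure_add_right[of _ a b] NQ.m_closed by simp
  next
    fix r a assume "r \<in> carrier R" "a \<in> ?S"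
    then show "r \<odot>\<^bsub>MD\<^esub> a \<in> ?S"
      using QD.pure_balanced[of r _ a, symmetric] \<psi> \<phi> by (auto simp: ring_hom_closed)
  qed auto
  moreover have "commutators D (carrier D) \<subseteq> ?S"
  proof
    fix c assume "c \<in> commutators D (carrier D)"
    then obtain a b where c: "a \<in> carrier D" "b \<in> carrier D" "c = a \<otimes>\<^bsub>D\<^esub> b \<ominus>\<^bsub>D\<^esub> b \<otimes>\<^bsub>D\<^esub> a"
      by (auto simp: commutators_def)
    have "pq k c \<in> NQ" if k: "k \<in> carrier K" for k
    proof -
      have inv: "\<ominus>\<^bsub>MD\<^esub> x = \<ominus>\<^bsub>D\<^esub> x" for x by (simp add: a_inv_def m_inv_def)
      interpret p: abelian_group_hom MD QD "\<lambda>d. pq k d" by (rule pq_left_hom[OF k])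
      have "pq k c = pq k a \<otimes>\<^bsub>QD\<^esub> pq \<one>\<^bsub>K\<^esub> b \<ominus>\<^bsub>QD\<^esub> pq \<one>\<^bsub>K\<^esub> b \<otimes>\<^bsub>QD\<^esub> pq k a"
        using c k p.hom_add[of "a \<otimes>\<^bsub>D\<^esub> b" "\<ominus>\<^bsub>D\<^esub> (b \<otimes>\<^bsub>D\<^esub> a)"] p.hom_a_inv[of "b \<otimes>\<^bsub>D\<^esub> a"]
        by (simp add: QD_mult a_minus_def inv)
      also have "\<dots> \<in> commutators QD (carrier QD)"
        unfolding commutators_def using c k QD.pure_closed[of k a] QD.pure_closed[of "\<one>\<^bsub>K\<^esub>" b]
        by (intro CollectI exI[of _ "pq k a"] exI[of _ "pq \<one>\<^bsub>K\<^esub> b"]) simp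
      finally show ?thesis using NQ(2) by blast
    qed
    then show "c \<in> ?S" using c by auto
  qed
  ultimately show ?thesis
    using ND(3) assms by blast
qed

lemma obtain_forward:
  obtains f where "abelian_group_hom V W f"
    "\<And>d k. d \<in> carrier D \<Longrightarrow> k \<in> carrier K \<Longrightarrow> f (pv (qD d) k) = qW (pq k d)"
proof -
  \<comment> \<open>Independence of the representative: \<open>d - d'\<close> lies in
    \<open>ND\<close>, and \<open>pq_ND\<close> moves it into \<open>NQ\<close>.\<close>
  have dep: "qW (pq k d) = qW (pq k d')"
    if "d \<in> carrier D" "d' \<in> carrier D" "qD d = qD d'" "k \<in> carrier K" for d d' k
  proof -
    interpret p: abelian_group_hom MD QD "\<lambda>d. pq k d" by (rule pq_left_hom[OF that(4)])
    have inv: "\<ominus>\<^bsub>MD\<^esub> d' \<in> carrier D" using QD.N.a_inv_closed[of d'] that by simp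
    have "qD (d \<ominus>\<^bsub>MD\<^esub> d') = \<zero>\<^bsub>DN\<^esub>"
      using that qD.hom_add[of d "\<ominus>\<^bsub>MD\<^esub> d'"] qD.hom_a_inv[of d'] inv qD.hom_closed[of d']
      by (simp add: a_minus_def V.M.r_neg)
    then have "d \<ominus>\<^bsub>MD\<^esub> d' \<in> ND"
      using DN(4)[of "d \<ominus>\<^bsub>MD\<^esub> d'"] QD.N.minus_closed[of d d'] that by simp
    then have "pq k (d \<ominus>\<^bsub>MD\<^esub> d') \<in> NQ" using pq_ND that by blast
    then have "qW (pq k (d \<ominus>\<^bsub>MD\<^esub> d')) = \<zero>\<^bsub>W\<^esub>"
      using W(4)[of "pq k (d \<ominus>\<^bsub>MD\<^esub> d')"] QD.N.minus_closed[of d d'] that by simp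
    then have "qW (pq k d) \<ominus>\<^bsub>W\<^esub> qW (pq k d') = \<zero>\<^bsub>W\<^esub>"
      using that p.hom_add[of d "\<ominus>\<^bsub>MD\<^esub> d'"] p.hom_a_inv[of d'] inv
      by (simp add: a_minus_def)
    then show ?thesis
      using that by (metis W.add.inv_solve_right' W.zero_closed W.l_zero W.minus_eq qW.hom_closed QD.pure_closed restrict_scalars_simps(1))
  qed
  \<comment> \<open>The universal property wants a function on cosets, so a representative is
    chosen. Fact \<open>b\<close> below removes the choice again.\<close>
  define rep where "rep x = (SOME d. d \<in> carrier D \<and> qD d = x)" for x
  have rep: "rep x \<in> carrier D" "qD (rep x) = x" if "x \<in> carrier DN" for x
    using someI_ex[of "\<lambda>d. d \<in> carrier D \<and> qD d = x"] that DN(3) by (auto simp: rep_def)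
  have b: "qW (pq k (rep (qD d))) = qW (pq k d)" if "d \<in> carrier D" "k \<in> carrier K" for d k
    using that rep[of "qD d"] qD.hom_closed[of d] by (intro dep) auto
  have DN_cases: "\<exists>d\<in>carrier D. x = qD d" if "x \<in> carrier DN" for x
    using that DN(3) by auto
  obtain f where f: "abelian_group_hom V W f"
    "\<And>x k. x \<in> carrier DN \<Longrightarrow> k \<in> carrier MK \<Longrightarrow> f (pv x k) = qW (pq k (rep x))"
  proof (rule V.tensor_universal[OF W.abelian_group_axioms, of "\<lambda>x k. qW (pq k (rep x))"])
    fix x k assume "x \<in> carrier DN" "k \<in> carrier MK"
    then show "qW (pq k (rep x)) \<in> carrier W" using rep by simp
  next
    fix x x' k assume *: "x \<in> carrier DN" "x' \<in> carrier DN" "k \<in> carrier MK"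
    then obtain d d' where d: "d \<in> carrier D" "x = qD d" "d' \<in> carrier D" "x' = qD d'"
      using DN_cases by metis
    then have "x \<oplus>\<^bsub>DN\<^esub> x' = qD (d \<oplus>\<^bsub>D\<^esub> d')" using qD.hom_add[of d d'] by simp
    then show "qW (pq k (rep (x \<oplus>\<^bsub>DN\<^esub> x'))) = qW (pq k (rep x)) \<oplus>\<^bsub>W\<^esub> qW (pq k (rep x'))"
      using d * QD.pure_add_right[of k d d'] by (simp add: b)
  next
    fix x k k' assume *: "x \<in> carrier DN" "k \<in> carrier MK" "k' \<in> carrier MK"
    then show "qW (pq (k \<oplus>\<^bsub>MK\<^esub> k') (rep x)) = qW (pq k (rep x)) \<oplus>\<^bsub>W\<^esub> qW (pq k' (rep x))"
      using QD.pure_add_left[of k k' "rep x"] rep by simp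
  next
    fix r x k assume *: "r \<in> carrier R" "x \<in> carrier DN" "k \<in> carrier MK"
    then obtain d where d: "d \<in> carrier D" "x = qD d" using DN_cases by metis
    then have "r \<odot>\<^bsub>DN\<^esub> x = qD (\<psi> r \<otimes>\<^bsub>D\<^esub> d)" using DN(5)[of r d] * by simp
    then show "qW (pq k (rep (r \<odot>\<^bsub>DN\<^esub> x))) = qW (pq (r \<odot>\<^bsub>MK\<^esub> k) (rep x))"
      using d * QD.pure_balanced[of r k d] \<psi> \<phi> by (simp add: b ring_hom_closed)
  qed blast
  then show thesis
    using that b qD.hom_closed by simp
qed

text \<open>Besides its values on pure tensors only the vanishing on \<open>NQ\<close> is recorded.
  As \<open>g\<close> is \<open>K\<close>-linear, its kernel is a submodule, so it is enough that
  \<open>g\<close> cannot tell \<open>u v\<close> from \<open>v u\<close>.\<close>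

lemma obtain_backward:
  obtains g where "abelian_group_hom QD V g"
    "\<And>d k. d \<in> carrier D \<Longrightarrow> k \<in> carrier K \<Longrightarrow> g (pq k d) = pv (qD d) k"
    "\<And>u. u \<in> NQ \<Longrightarrow> g u = \<zero>\<^bsub>V\<^esub>"
proof -
  obtain g where g: "abelian_group_hom QD V g"
    "\<And>k d. k \<in> carrier MK \<Longrightarrow> d \<in> carrier MD \<Longrightarrow> g (pq k d) = pv (qD d) k"
  proof (rule QD.tensor_universal[OF V.T.abelian_group_axioms, of "\<lambda>k d. pv (qD d) k"])
    fix r k d assume *: "r \<in> carrier R" "k \<in> carrier MK" "d \<in> carrier MD"
    then show "pv (qD d) (r \<odot>\<^bsub>MK\<^esub> k) = pv (qD (r \<odot>\<^bsub>MD\<^esub> d)) k"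
      using V.pure_balanced[of r "qD d" k] DN(5)[of r d] qD.hom_closed[of d] by simp
  \<comment> \<open>The simplification rules would turn the additions of \<open>MD\<close> and
    \<open>MK\<close> into those of \<open>D\<close> and \<open>K\<close>, on which the additivity
    rules no longer match.\<close>
  qed (simp_all add: V.pure_add_left V.pure_add_right del: restrict_scalars_simps)
  interpret g: abelian_group_hom QD V g by (rule g(1))
  have g_pure: "g (pq k d) = pv (qD d) k" if "k \<in> carrier K" "d \<in> carrier D" for k d
    using g(2) that by simp
  have qD_closed [simp]: "qD d \<in> carrier DN" if "d \<in> carrier D" for d
    using qD.hom_closed that by simp
  have g_smult: "g (k \<odot>\<^bsub>QD\<^esub> u) = k \<odot>\<^bsub>V\<^esub> g u" if "u \<in> carrier QD" "k \<in> carrier K" for k u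
    using that
  proof (induction rule: QD.tensor_induct)
    case (pure x y)
    then show ?case using QD(3)[of k x y] V(3)[of k "qD y" x] by (simp add: g_pure)
  qed (simp_all add: QDm.smult_r_distr Vm.smult_r_distr QDm.smult_r_minus Vm.smult_r_minus)
  have qD_comm: "qD (a \<otimes>\<^bsub>D\<^esub> b) = qD (b \<otimes>\<^bsub>D\<^esub> a)" if ab: "a \<in> carrier D" "b \<in> carrier D" for a b
  proof -
    have "a \<otimes>\<^bsub>D\<^esub> b \<ominus>\<^bsub>D\<^esub> b \<otimes>\<^bsub>D\<^esub> a \<in> ND"
      using ND(2) ab by (auto simp: commutators_def)
    then have "qD (a \<otimes>\<^bsub>D\<^esub> b \<ominus>\<^bsub>D\<^esub> b \<otimes>\<^bsub>D\<^esub> a) = \<zero>\<^bsub>DN\<^esub>"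
      using DN(4)[of "a \<otimes>\<^bsub>D\<^esub> b \<ominus>\<^bsub>D\<^esub> b \<otimes>\<^bsub>D\<^esub> a"] ab by simp
    moreover have "a \<otimes>\<^bsub>D\<^esub> b = (a \<otimes>\<^bsub>D\<^esub> b \<ominus>\<^bsub>D\<^esub> b \<otimes>\<^bsub>D\<^esub> a) \<oplus>\<^bsub>D\<^esub> b \<otimes>\<^bsub>D\<^esub> a"
      using ab by (simp add: a_minus_def D.a_assoc D.l_neg)
    moreover have "qD ((a \<otimes>\<^bsub>D\<^esub> b \<ominus>\<^bsub>D\<^esub> b \<otimes>\<^bsub>D\<^esub> a) \<oplus>\<^bsub>D\<^esub> b \<otimes>\<^bsub>D\<^esub> a) =
        qD (a \<otimes>\<^bsub>D\<^esub> b \<ominus>\<^bsub>D\<^esub> b \<otimes>\<^bsub>D\<^esub> a) \<oplus>\<^bsub>DN\<^esub> qD (b \<otimes>\<^bsub>D\<^esub> a)"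
      using qD.hom_add[of "a \<otimes>\<^bsub>D\<^esub> b \<ominus>\<^bsub>D\<^esub> b \<otimes>\<^bsub>D\<^esub> a" "b \<otimes>\<^bsub>D\<^esub> a"] ab by simp
    ultimately show ?thesis using ab by (simp add: V.M.l_zero)
  qed
  \<comment> \<open>Both sides are biadditive in the two factors, so each factor is reduced to pure
    tensors in turn. For two pure tensors \<open>K\<close> is commutative and \<open>qD\<close>
    forgets the order of factors.\<close>
  have g_comm1: "g (u \<otimes>\<^bsub>QD\<^esub> pq k d) = g (pq k d \<otimes>\<^bsub>QD\<^esub> u)"
    if "u \<in> carrier QD" "k \<in> carrier K" "d \<in> carrier D" for u k d
    using that
    by (induction rule: QD.tensor_induct)
       (simp_all add: QD_mult_simps QD_mult(3) g_pure qD_comm K.m_comm)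
  have g_comm: "g (u \<otimes>\<^bsub>QD\<^esub> v) = g (v \<otimes>\<^bsub>QD\<^esub> u)" if "v \<in> carrier QD" "u \<in> carrier QD" for u v
    using that
    by (induction rule: QD.tensor_induct) (simp_all add: QD_mult_simps g_comm1)
  let ?S = "{u \<in> carrier QD. g u = \<zero>\<^bsub>V\<^esub>}"
  have "submodule ?S K QD"
    by (rule QDm.submoduleI) (auto simp: g_smult)
  moreover have "commutators QD (carrier QD) \<subseteq> ?S"
    by (auto simp: commutators_def a_minus_def QD_mult_simps g_comm V.T.r_neg)
  ultimately have "NQ \<subseteq> ?S" by (rule NQ(3))
  then show thesis
    using that[of g] g_pure g(1) by auto
qed

text \<open>Surjectivity of \<open>f\<close> comes from \<open>f (g u) = qW u\<close>. For
  injectivity an element of \<open>V\<close> killed by \<open>f\<close> is written as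
  \<open>g u\<close>; then \<open>qW u\<close> is zero, so \<open>u\<close> lies in
  \<open>NQ\<close>, where \<open>g\<close> vanishes.\<close>

theorem base_change_iso:
  shows "module K V" "module K W"
    and "\<exists>f \<in> iso (add_monoid V) (add_monoid W).
      \<forall>k\<in>carrier K. \<forall>v\<in>carrier V. f (k \<odot>\<^bsub>V\<^esub> v) = k \<odot>\<^bsub>W\<^esub> f v"
proof -
  obtain f where f: "abelian_group_hom V W f"
    "\<And>d k. d \<in> carrier D \<Longrightarrow> k \<in> carrier K \<Longrightarrow> f (pv (qD d) k) = qW (pq k d)"
    by (rule obtain_forward) blast
  obtain g where g: "abelian_group_hom QD V g"
    "\<And>d k. d \<in> carrier D \<Longrightarrow> k \<in> carrier K \<Longrightarrow> g (pq k d) = pv (qD d) k"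
    "\<And>u. u \<in> NQ \<Longrightarrow> g u = \<zero>\<^bsub>V\<^esub>"
    by (rule obtain_backward) blast
  interpret f: abelian_group_hom V W f by (rule f(1))
  interpret g: abelian_group_hom QD V g by (rule g(1))
  have DN_cases: "\<exists>d\<in>carrier D. x = qD d" if "x \<in> carrier DN" for x
    using that DN(3) by auto
  have qD_closed [simp]: "qD d \<in> carrier DN" if "d \<in> carrier D" for d
    using qD.hom_closed that by simp
  have fg: "f (g u) = qW u" if "u \<in> carrier QD" for u
    using that by (induction rule: QD.tensor_induct) (simp_all add: f(2) g(2))
  \<comment> \<open>The image of \<open>g\<close> is a subgroup that contains every pure tensor,
    because each element of \<open>DN\<close> is a coset \<open>qD d\<close>.\<close>
  have lift: "\<exists>u\<in>carrier QD. v = g u" if "v \<in> carrier V" for v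
    using that
  proof (induction rule: V.tensor_induct)
    case zero
    then show ?case using g.hom_zero QD.T.zero_closed by metis
  next
    case (add v w)
    then show ?case using g.hom_add QD.T.a_closed by metis
  next
    case (uminus v)
    then show ?case using g.hom_a_inv QD.T.a_inv_closed by metis
  next
    case (pure x k)
    then obtain d where "d \<in> carrier D" "x = qD d" using DN_cases by metis
    then show ?case using pure g(2)[of d k] by (intro bexI[of _ "pq k d"]) simp_all
  qed
  have f_smult: "f (k \<odot>\<^bsub>V\<^esub> v) = k \<odot>\<^bsub>W\<^esub> f v" if "v \<in> carrier V" "k \<in> carrier K" for k v
    using that
  proof (induction rule: V.tensor_induct)
    case (pure x l)
    then obtain d where d: "d \<in> carrier D" "x = qD d" using DN_cases by metis
    then show ?case
      using pure f(2) V(3)[of k x l] W(5)[of k "pq l d"] QD(3)[of k l d] by simp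
  qed (simp_all add: Vm.smult_r_distr Wm.smult_r_distr Vm.smult_r_minus Wm.smult_r_minus)
  have "inj_on f (carrier V)"
  proof -
    have "v = \<zero>\<^bsub>V\<^esub>" if v: "v \<in> carrier V" "f v = \<zero>\<^bsub>W\<^esub>" for v
    proof -
      obtain u where u: "u \<in> carrier QD" "v = g u" using lift v by blast
      then have "u \<in> NQ" using fg[of u] v W(4)[of u] by simp
      then show ?thesis using g(3) u by simp
    qed
    then have "kernel (add_monoid V) (add_monoid W) f = {\<one>\<^bsub>add_monoid V\<^esub>}"
      by (auto simp: kernel_def)
    then show ?thesis
      using group_hom.inj_iff_trivial_ker[OF f.a_group_hom] by simp
  qed
  moreover have "f ` carrier V = carrier W"
  proof
    show "carrier W \<subseteq> f ` carrier V"
      unfolding W(3) using fg by (auto intro!: image_eqI simp flip: fg)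
  qed auto
  ultimately have "f \<in> iso (add_monoid V) (add_monoid W)"
    by (auto simp: iso_def bij_betw_def hom_def)
  then show "\<exists>f \<in> iso (add_monoid V) (add_monoid W).
      \<forall>k\<in>carrier K. \<forall>v\<in>carrier V. f (k \<odot>\<^bsub>V\<^esub> v) = k \<odot>\<^bsub>W\<^esub> f v"
    using f_smult by blast
  show "module K V" "module K W" by (rule V(2) W(1))+
qed

end


section \<open>The quotient field of a domain\<close>

context domain
begin

abbreviation "nonzero \<equiv> carrier R - {\<zero>}"
abbreviation "quot a s \<equiv> fraction R nonzero a s"
abbreviation "QR \<equiv> quotient_field R"

lemma nonzero_mult: "s \<in> nonzero \<Longrightarrow> t \<in> nonzero \<Longrightarrow> s \<otimes> t \<in> nonzero"
  using integral by auto

text \<open>The auxiliary factor in the general definition of a localization can be cancelled in a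
  domain.\<close>

lemma fraction_rel_iff:
  "((a, s), (b, t)) \<in> fraction_rel R nonzero \<longleftrightarrow>
     a \<in> carrier R \<and> b \<in> carrier R \<and> s \<in> nonzero \<and> t \<in> nonzero \<and> a \<otimes> t = b \<otimes> s"
  using m_lcancel by (auto simp: fraction_rel_def)

lemma fraction_rel_equiv: "equiv (carrier R \<times> nonzero) (fraction_rel R nonzero)"
proof (rule equivI)
  show "fraction_rel R nonzero \<subseteq> (carrier R \<times> nonzero) \<times> (carrier R \<times> nonzero)"
    by (auto simp: fraction_rel_def)
  show "refl_on (carrier R \<times> nonzero) (fraction_rel R nonzero)"
    by (auto simp: refl_on_def fraction_rel_iff)
  show "sym (fraction_rel R nonzero)"
    by (auto simp: sym_def fraction_rel_iff)
  show "trans (fraction_rel R nonzero)"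
  proof (rule transI, clarsimp simp: fraction_rel_iff)
    fix a s b t c u
    assume *: "a \<in> carrier R" "b \<in> carrier R" "c \<in> carrier R"
      "s \<in> carrier R" "t \<in> carrier R" "u \<in> carrier R" "t \<noteq> \<zero>"
      "a \<otimes> t = b \<otimes> s" "b \<otimes> u = c \<otimes> t"
    \<comment> \<open>Transitivity holds after multiplication by the middle denominator
      \<open>t\<close>, which is then cancelled.\<close>
    from *(1-6) have "t \<otimes> (a \<otimes> u) = (a \<otimes> t) \<otimes> u" by (simp add: m_ac)
    also have "\<dots> = (b \<otimes> u) \<otimes> s" unfolding *(8) using *(1-6) by (simp add: m_ac)
    also have "\<dots> = t \<otimes> (c \<otimes> s)" unfolding *(9) using *(1-6) by (simp add: m_ac)
    finally show "a \<otimes> u = c \<otimes> s" using * by (simp add: m_lcancel)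
  qed
qed

lemma frac_eq_iff:
  assumes "a \<in> carrier R" "s \<in> nonzero" "b \<in> carrier R" "t \<in> nonzero"
  shows "quot a s = quot b t \<longleftrightarrow> a \<otimes> t = b \<otimes> s"
  using eq_equiv_class_iff[OF fraction_rel_equiv, of "(a, s)" "(b, t)"] assms
  by (simp add: fraction_def fraction_rel_iff)

lemma frac_mem_iff:
  "(b, t) \<in> quot a s \<longleftrightarrow>
     a \<in> carrier R \<and> b \<in> carrier R \<and> s \<in> nonzero \<and> t \<in> nonzero \<and> a \<otimes> t = b \<otimes> s"
  by (simp only: fraction_def Image_singleton_iff fraction_rel_iff)

lemma carrier_QR: "carrier QR = {quot a s | a s. a \<in> carrier R \<and> s \<in> nonzero}"
  by (auto simp: quotient_field_def localization_def quotient_def fraction_def)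

lemma one_QR: "\<one>\<^bsub>QR\<^esub> = quot \<one> \<one>" and zero_QR: "\<zero>\<^bsub>QR\<^esub> = quot \<zero> \<one>"
  by (simp_all add: quotient_field_def localization_def)

text \<open>A union of equal sets over a non-empty index set is that set. The premise
  \<open>const\<close> is the well-definedness that has to be checked for each operation on
  fractions.\<close>

lemma Union_frac:
  assumes a: "a \<in> carrier R" "s \<in> nonzero" and b: "b \<in> carrier R" "t \<in> nonzero"
    and const: "\<And>a' s' b' t'. a' \<in> carrier R \<Longrightarrow> s' \<in> nonzero \<Longrightarrow> a \<otimes> s' = a' \<otimes> s \<Longrightarrow>
      b' \<in> carrier R \<Longrightarrow> t' \<in> nonzero \<Longrightarrow> b \<otimes> t' = b' \<otimes> t \<Longrightarrow> h a' s' b' t' = h a s b t"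
  shows "(\<Union>(a', s')\<in>quot a s. \<Union>(b', t')\<in>quot b t. h a' s' b' t') = h a s b t"
proof -
  have mem: "(a, s) \<in> quot a s" "(b, t) \<in> quot b t" using a b by (simp_all only: frac_mem_iff)
  have eq: "h a' s' b' t' = h a s b t" if "(a', s') \<in> quot a s" "(b', t') \<in> quot b t" for a' s' b' t'
    using that unfolding frac_mem_iff by (intro const) simp_all
  have "(\<Union>(b', t')\<in>quot b t. h a' s' b' t') = h a s b t" if "(a', s') \<in> quot a s" for a' s'
    by (rule SUP_eq_const) (use mem eq[OF that] in auto)
  then show ?thesis
    by (intro SUP_eq_const) (use mem in auto)
qed

lemma mult_QR:
  assumes "a \<in> carrier R" "s \<in> nonzero" "b \<in> carrier R" "t \<in> nonzero"
  shows "quot a s \<otimes>\<^bsub>QR\<^esub> quot b t = quot (a \<otimes> b) (s \<otimes> t)"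
proof -
  have "quot a s \<otimes>\<^bsub>QR\<^esub> quot b t =
      (\<Union>(a', s')\<in>quot a s. \<Union>(b', t')\<in>quot b t. quot (a' \<otimes> b') (s' \<otimes> t'))"
    by (simp add: quotient_field_def localization_def)
  also have "\<dots> = quot (a \<otimes> b) (s \<otimes> t)"
  proof (rule Union_frac[OF assms])
    fix a' s' b' t'
    assume *: "a' \<in> carrier R" "s' \<in> nonzero" "a \<otimes> s' = a' \<otimes> s"
      "b' \<in> carrier R" "t' \<in> nonzero" "b \<otimes> t' = b' \<otimes> t"
    note c = *(1,2,4,5) assms
    from c have "(a' \<otimes> b') \<otimes> (s \<otimes> t) = (a' \<otimes> s) \<otimes> (b' \<otimes> t)"
      by (simp add: m_ac)
    also have "\<dots> = (a \<otimes> s') \<otimes> (b \<otimes> t')" by (simp only: *)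
    also have "\<dots> = (a \<otimes> b) \<otimes> (s' \<otimes> t')" using c by (simp add: m_ac)
    finally show "quot (a' \<otimes> b') (s' \<otimes> t') = quot (a \<otimes> b) (s \<otimes> t)"
      using * assms nonzero_mult[of s t] nonzero_mult[of s' t'] by (simp add: frac_eq_iff)
  qed
  finally show ?thesis .
qed

lemma add_QR:
  assumes "a \<in> carrier R" "s \<in> nonzero" "b \<in> carrier R" "t \<in> nonzero"
  shows "quot a s \<oplus>\<^bsub>QR\<^esub> quot b t = quot (a \<otimes> t \<oplus> b \<otimes> s) (s \<otimes> t)"
proof -
  have "quot a s \<oplus>\<^bsub>QR\<^esub> quot b t =
      (\<Union>(a', s')\<in>quot a s. \<Union>(b', t')\<in>quot b t. quot (a' \<otimes> t' \<oplus> b' \<otimes> s') (s' \<otimes> t'))"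
    by (simp add: quotient_field_def localization_def)
  also have "\<dots> = quot (a \<otimes> t \<oplus> b \<otimes> s) (s \<otimes> t)"
  proof (rule Union_frac[OF assms])
    fix a' s' b' t'
    assume *: "a' \<in> carrier R" "s' \<in> nonzero" "a \<otimes> s' = a' \<otimes> s"
      "b' \<in> carrier R" "t' \<in> nonzero" "b \<otimes> t' = b' \<otimes> t"
    note c = *(1,2,4,5) assms
    from c have "(a' \<otimes> t' \<oplus> b' \<otimes> s') \<otimes> (s \<otimes> t) =
        (a' \<otimes> s) \<otimes> (t' \<otimes> t) \<oplus> (b' \<otimes> t) \<otimes> (s' \<otimes> s)"
      by (simp add: l_distr r_distr m_ac)
    also have "\<dots> = (a \<otimes> s') \<otimes> (t' \<otimes> t) \<oplus> (b \<otimes> t') \<otimes> (s' \<otimes> s)" by (simp only: *)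
    also have "\<dots> = (a \<otimes> t \<oplus> b \<otimes> s) \<otimes> (s' \<otimes> t')"
      using c by (simp add: l_distr r_distr m_ac)
    finally show "quot (a' \<otimes> t' \<oplus> b' \<otimes> s') (s' \<otimes> t') = quot (a \<otimes> t \<oplus> b \<otimes> s) (s \<otimes> t)"
      using * assms nonzero_mult[of s t] nonzero_mult[of s' t'] by (simp add: frac_eq_iff)
  qed
  finally show ?thesis .
qed

lemma field_QR: "field QR"
proof -
  have cases: "\<exists>a s. a \<in> carrier R \<and> s \<in> nonzero \<and> x = quot a s" if "x \<in> carrier QR" for x
    using that by (auto simp only: carrier_QR)
  have in_QR: "quot a s \<in> carrier QR" if "a \<in> carrier R" "s \<in> nonzero" for a s
    using that by (auto simp only: carrier_QR)
  have one_nz: "\<one> \<in> nonzero" by simp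
  have nzc: "s \<in> carrier R" if "s \<in> nonzero" for s using that by simp
  \<comment> \<open>These rules turn a field axiom into a cross-multiplied identity in the domain.
    Where \<open>Diff_iff\<close> is deleted, membership in \<open>nonzero\<close> stays a single
    condition, the form in which the rules expect it.\<close>
  note calc = nzc mult_QR add_QR one_QR zero_QR frac_eq_iff nonzero_mult in_QR one_nz
  have ab: "abelian_group QR"
  proof (rule abelian_groupI)
    fix x y z assume "x \<in> carrier QR" "y \<in> carrier QR" "z \<in> carrier QR"
    then obtain a s b t c u where *: "a \<in> carrier R" "s \<in> nonzero" "x = quot a s"
      "b \<in> carrier R" "t \<in> nonzero" "y = quot b t" "c \<in> carrier R" "u \<in> nonzero" "z = quot c u"
      using cases by metis
    then show "x \<oplus>\<^bsub>QR\<^esub> y \<oplus>\<^bsub>QR\<^esub> z = x \<oplus>\<^bsub>QR\<^esub> (y \<oplus>\<^bsub>QR\<^esub> z)"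
      by (simp add: calc del: Diff_iff) (simp add: l_distr r_distr m_ac a_ac)
  next
    fix x y assume "x \<in> carrier QR" "y \<in> carrier QR"
    then obtain a s b t where *: "a \<in> carrier R" "s \<in> nonzero" "x = quot a s"
      "b \<in> carrier R" "t \<in> nonzero" "y = quot b t"
      using cases by metis
    then show "x \<oplus>\<^bsub>QR\<^esub> y = y \<oplus>\<^bsub>QR\<^esub> x" 
      by (simp add: calc del: Diff_iff) (simp add: l_distr r_distr m_ac a_ac)
    show "x \<oplus>\<^bsub>QR\<^esub> y \<in> carrier QR" 
      using * by (simp add: calc del: Diff_iff)
  next
    fix x assume "x \<in> carrier QR"
    then obtain a s where *: "a \<in> carrier R" "s \<in> nonzero" "x = quot a s"
      using cases by metis
    then show "\<zero>\<^bsub>QR\<^esub> \<oplus>\<^bsub>QR\<^esub> x = x"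
      by (simp add: calc del: Diff_iff)
    have "quot (\<ominus> a) s \<oplus>\<^bsub>QR\<^esub> x = \<zero>\<^bsub>QR\<^esub>"
      using * by (simp add: calc l_minus l_neg del: Diff_iff)
    then show "\<exists>y\<in>carrier QR. y \<oplus>\<^bsub>QR\<^esub> x = \<zero>\<^bsub>QR\<^esub>"
      using * in_QR[of "\<ominus> a" s] by auto
  next
    show "\<zero>\<^bsub>QR\<^esub> \<in> carrier QR" by (simp add: zero_QR in_QR)
  qed
  have cm: "comm_monoid QR"
  proof (rule comm_monoidI)
    fix x y z assume "x \<in> carrier QR" "y \<in> carrier QR" "z \<in> carrier QR"
    then obtain a s b t c u where *: "a \<in> carrier R" "s \<in> nonzero" "x = quot a s"
      "b \<in> carrier R" "t \<in> nonzero" "y = quot b t" "c \<in> carrier R" "u \<in> nonzero" "z = quot c u"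
      using cases by metis
    then show "x \<otimes>\<^bsub>QR\<^esub> y \<otimes>\<^bsub>QR\<^esub> z = x \<otimes>\<^bsub>QR\<^esub> (y \<otimes>\<^bsub>QR\<^esub> z)"
      by (simp add: calc del: Diff_iff) (simp add: m_ac)
  next
    fix x y assume "x \<in> carrier QR" "y \<in> carrier QR"
    then obtain a s b t where *: "a \<in> carrier R" "s \<in> nonzero" "x = quot a s"
      "b \<in> carrier R" "t \<in> nonzero" "y = quot b t"
      using cases by metis
    then show "x \<otimes>\<^bsub>QR\<^esub> y = y \<otimes>\<^bsub>QR\<^esub> x" "x \<otimes>\<^bsub>QR\<^esub> y \<in> carrier QR" 
      by (simp_all add: calc m_comm del: Diff_iff)
  next
    fix x assume "x \<in> carrier QR"
    then obtain a s where *: "a \<in> carrier R" "s \<in> nonzero" "x = quot a s"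
      using cases by metis
    then show "\<one>\<^bsub>QR\<^esub> \<otimes>\<^bsub>QR\<^esub> x = x"
      by (simp add: calc del: Diff_iff)
  next
    show "\<one>\<^bsub>QR\<^esub> \<in> carrier QR" by (simp add: one_QR in_QR)
  qed
  interpret Q: cring QR
  proof (rule cringI[OF ab cm])
    fix x y z assume "x \<in> carrier QR" "y \<in> carrier QR" "z \<in> carrier QR"
    then obtain a s b t c u where *: "a \<in> carrier R" "s \<in> nonzero" "x = quot a s"
      "b \<in> carrier R" "t \<in> nonzero" "y = quot b t" "c \<in> carrier R" "u \<in> nonzero" "z = quot c u"
      using cases by metis
    then show "(x \<oplus>\<^bsub>QR\<^esub> y) \<otimes>\<^bsub>QR\<^esub> z = x \<otimes>\<^bsub>QR\<^esub> z \<oplus>\<^bsub>QR\<^esub> y \<otimes>\<^bsub>QR\<^esub> z"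
      by (simp add: calc del: Diff_iff) (simp add: l_distr r_distr m_ac a_ac)
  qed
  show "field QR"
  proof (rule Q.cring_fieldI)
    have nz: "\<one>\<^bsub>QR\<^esub> \<noteq> \<zero>\<^bsub>QR\<^esub>" by (simp add: one_QR zero_QR frac_eq_iff)
    have "x \<in> Units QR" if x: "x \<in> carrier QR" "x \<noteq> \<zero>\<^bsub>QR\<^esub>" for x
    proof -
      obtain a s where *: "a \<in> carrier R" "s \<in> nonzero" "x = quot a s"
        using cases[OF x(1)] by blast
      have "a \<noteq> \<zero>"
        using x(2) *(2) frac_eq_iff[of \<zero> s \<zero> \<one>] unfolding *(3) zero_QR by auto
      then have a: "a \<in> nonzero" using *(1) by simp
      then have in_s: "quot s a \<in> carrier QR" using *(2) by (simp add: in_QR)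
      have "quot s a \<otimes>\<^bsub>QR\<^esub> x = quot (s \<otimes> a) (a \<otimes> s)"
        using a * mult_QR[of s a a s] by simp
      also have "\<dots> = \<one>\<^bsub>QR\<^esub>"
        unfolding one_QR using a * nonzero_mult[of a s] m_comm[of s a] by (simp add: frac_eq_iff)
      finally have "quot s a \<otimes>\<^bsub>QR\<^esub> x = \<one>\<^bsub>QR\<^esub>" .
      with in_s show ?thesis
        using x(1) Q.m_comm[OF in_s x(1)] unfolding Units_def
        by (intro CollectI conjI bexI[of _ "quot s a"]) simp_all
    qed
    moreover have "\<zero>\<^bsub>QR\<^esub> \<notin> Units QR"
      using nz Q.Units_r_inv_ex[of "\<zero>\<^bsub>QR\<^esub>"] by auto
    ultimately show "Units QR = carrier QR - {\<zero>\<^bsub>QR\<^esub>}"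
      by (auto simp: Units_def)
  qed
qed

lemma to_quotient_field_hom: "to_quotient_field R \<in> ring_hom R QR"
proof (rule ring_hom_memI)
  fix x y assume "x \<in> carrier R" "y \<in> carrier R"
  then show "to_quotient_field R (x \<otimes> y) = to_quotient_field R x \<otimes>\<^bsub>QR\<^esub> to_quotient_field R y"
    and "to_quotient_field R (x \<oplus> y) = to_quotient_field R x \<oplus>\<^bsub>QR\<^esub> to_quotient_field R y"
    using mult_QR[of x \<one> y \<one>] add_QR[of x \<one> y \<one>] by (simp_all add: to_quotient_field_def)
next
  fix x assume "x \<in> carrier R"
  moreover have "\<one> \<in> nonzero" by simp
  ultimately show "to_quotient_field R x \<in> carrier QR"
    unfolding to_quotient_field_def carrier_QR by blast
qed (simp add: to_quotient_field_def one_QR)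

end


section \<open>Torsion-free abelian groups\<close>

text \<open>The elements above \<open>\<one>\<close> for a translation-invariant partial order, with
  \<open>a\<close> below \<open>m\<close> when \<open>m \<otimes> inv a\<close> is in
  \<open>P\<close>. The last clause is antisymmetry; totality is added by maximality.\<close>

definition (in group) cone :: "'a set \<Rightarrow> bool" where
  "cone P \<longleftrightarrow> P \<subseteq> carrier G \<and> \<one> \<in> P \<and> (\<forall>x\<in>P. \<forall>y\<in>P. x \<otimes> y \<in> P) \<and>
     (\<forall>x\<in>P. inv x \<in> P \<longrightarrow> x = \<one>)"

lemma (in group) cone_pow: "cone P \<Longrightarrow> x \<in> P \<Longrightarrow> x [^] (n::nat) \<in> P"
  by (induction n) (auto simp: cone_def)

text \<open>A maximal cone is total. If \<open>x\<close> is not in \<open>P\<close>, adjoining it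
  must destroy antisymmetry, and this puts the inverse of some positive power of \<open>x\<close>
  into \<open>P\<close>. If \<open>inv x\<close> is missing as well, some positive power of
  \<open>x\<close> also lies in \<open>P\<close>. A common multiple of the exponents gives a power
  of \<open>x\<close> that is in \<open>P\<close> together with its inverse, hence is trivial,
  against torsion-freeness.\<close>

lemma (in comm_group) torsion_free_total_cone:
  assumes "torsion_free G"
  obtains P where "cone P" "\<And>x. x \<in> carrier G \<Longrightarrow> x \<in> P \<or> inv x \<in> P"
proof -
  have "\<exists>P\<in>Collect cone. \<forall>Q\<in>Collect cone. P \<subseteq> Q \<longrightarrow> Q = P"
  proof (rule subset_Zorn_nonempty)
    show "Collect cone \<noteq> {}" by (auto simp: cone_def intro!: exI[of _ "{\<one>}"])
  next
    fix \<C> assume ne: "\<C> \<noteq> {}" and ch: "subset.chain (Collect cone) \<C>"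
    have cone: "cone P" if "P \<in> \<C>" for P using ch that by (auto simp: subset.chain_def)
    \<comment> \<open>Each condition involves at most two elements of the union, and two elements
      lie in a common member of the chain.\<close>
    have mult: "x \<otimes> y \<in> \<Union>\<C>" and antisym: "inv x = y \<Longrightarrow> x = \<one>"
      if xy: "x \<in> \<Union>\<C>" "y \<in> \<Union>\<C>" for x y
    proof -
      obtain P Q where PQ: "P \<in> \<C>" "x \<in> P" "Q \<in> \<C>" "y \<in> Q" using xy by blast
      then have "P \<subseteq> Q \<or> Q \<subseteq> P" using ch by (simp add: subset_chain_def)
      then obtain S where "S \<in> \<C>" "x \<in> S" "y \<in> S" using PQ by blast
      then show "x \<otimes> y \<in> \<Union>\<C>" "inv x = y \<Longrightarrow> x = \<one>"
        using cone[of S] by (auto simp: cone_def)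
    qed
    have "\<Union>\<C> \<subseteq> carrier G" "\<one> \<in> \<Union>\<C>"
      using cone ne unfolding cone_def by blast+
    then have "cone (\<Union>\<C>)"
      unfolding cone_def using mult antisym by blast
    then show "\<Union>\<C> \<in> Collect cone" by simp
  qed
  then obtain P where P: "cone P" and max: "\<And>Q. cone Q \<Longrightarrow> P \<subseteq> Q \<Longrightarrow> Q = P" by blast
  have P_carr: "p \<in> carrier G" if "p \<in> P" for p using P that by (auto simp: cone_def)
  have step: "\<exists>k::nat. 0 < k \<and> inv (x [^] k) \<in> P" if x: "x \<in> carrier G" "x \<notin> P" for x
  proof -
    \<comment> \<open>The submonoid generated by \<open>P\<close> and \<open>x\<close>. It is
      strictly larger than \<open>P\<close>, so only antisymmetry can fail.\<close>
    define Q where "Q = {p \<otimes> x [^] (n::nat) | p n. p \<in> P}"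
    have Q_I: "p \<otimes> x [^] n \<in> Q" if "p \<in> P" for p and n :: nat
      using that unfolding Q_def by blast
    have PQ: "P \<subseteq> Q"
    proof
      fix p assume "p \<in> P"
      then show "p \<in> Q" using Q_I[of p 0] P_carr by simp
    qed
    have "x \<in> Q"
      using Q_I[of "\<one>" 1] P x by (simp add: cone_def)
    then have "\<not> cone Q" using max[OF _ PQ] x by auto
    moreover have "Q \<subseteq> carrier G" using P_carr x by (auto simp: Q_def)
    moreover have "\<one> \<in> Q" using P PQ by (auto simp: cone_def)
    moreover have "y \<otimes> z \<in> Q" if yz: "y \<in> Q" "z \<in> Q" for y z
    proof -
      obtain p n q m where "p \<in> P" "y = p \<otimes> x [^] (n::nat)" "q \<in> P" "z = q \<otimes> x [^] (m::nat)"
        using yz unfolding Q_def by blast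
      then have "p \<otimes> q \<in> P" "y \<otimes> z = (p \<otimes> q) \<otimes> x [^] (n + m)"
        using P P_carr x by (auto simp: cone_def m_ac simp flip: nat_pow_mult)
      then show ?thesis using Q_I by simp
    qed
    ultimately have "\<not> (\<forall>y\<in>Q. inv y \<in> Q \<longrightarrow> y = \<one>)"
      by (simp add: cone_def)
    then obtain y where y: "y \<in> Q" "inv y \<in> Q" "y \<noteq> \<one>" by blast
    obtain p n where pn: "p \<in> P" "y = p \<otimes> x [^] (n::nat)" using y(1) unfolding Q_def by blast
    obtain q m where qm: "q \<in> P" "inv y = q \<otimes> x [^] (m::nat)" using y(2) unfolding Q_def by blast
    note carr = P_carr[OF pn(1)] P_carr[OF qm(1)] x(1)
    have "(p \<otimes> q) \<otimes> x [^] (n + m) = (p \<otimes> x [^] n) \<otimes> (q \<otimes> x [^] m)"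
      using carr by (simp add: m_ac flip: nat_pow_mult)
    also have "\<dots> = y \<otimes> inv y" using pn(2) qm(2) by simp
    finally have eq: "(p \<otimes> q) \<otimes> x [^] (n + m) = \<one>" using pn carr by simp
    have pq: "p \<otimes> q \<in> P" using P pn qm by (auto simp: cone_def)
    \<comment> \<open>With both exponents zero, antisymmetry of \<open>P\<close> itself would force
      \<open>p\<close> and hence \<open>y\<close> to be trivial.\<close>
    have "n + m \<noteq> 0"
    proof
      assume "n + m = 0"
      then have "p \<otimes> q = \<one>" using eq carr by simp
      then have "inv p = q" using carr inv_equality[of q p] m_comm[of p q] by simp
      then have "p = \<one>" using P pn(1) qm(1) by (simp add: cone_def)
      then show False using \<open>n + m = 0\<close> pn(2) y(3) by simp
    qed
    moreover have "inv (x [^] (n + m)) = p \<otimes> q"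
      using carr inv_equality[OF eq] by simp
    ultimately show ?thesis using pq by (intro exI[of _ "n + m"]) simp
  qed
  have "x \<in> P \<or> inv x \<in> P" if x: "x \<in> carrier G" for x
  proof (rule ccontr)
    assume neg: "\<not> (x \<in> P \<or> inv x \<in> P)"
    then obtain k l :: nat where kl: "0 < k" "inv (x [^] k) \<in> P" "0 < l" "inv (inv x [^] l) \<in> P"
      using step[of x] step[of "inv x"] x by auto
    have "(x [^] l) [^] k \<in> P"
      using cone_pow[OF P kl(4), of k] x by (simp add: nat_pow_inv)
    moreover have "inv ((x [^] k) [^] l) \<in> P"
      using cone_pow[OF P kl(2), of l] x by (simp add: nat_pow_inv)
    ultimately have "x [^] (k * l) \<in> P" "inv (x [^] (k * l)) \<in> P"
      using x by (simp_all add: nat_pow_pow mult.commute)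
    then have "x [^] (k * l) = \<one>" using P by (auto simp: cone_def)
    moreover have "0 < k * l" using kl by simp
    ultimately have "x = \<one>" using assms x unfolding torsion_free_def by blast
    then show False using neg P by (simp add: cone_def)
  qed
  with P that show thesis by blast
qed

text \<open>Take \<open>a\<close> and \<open>b\<close> greatest for the order given by a total cone.
  If \<open>a' \<otimes> b' = a \<otimes> b\<close>, then \<open>a \<otimes> inv a'\<close> and
  \<open>b \<otimes> inv b'\<close> are elements of the cone with product \<open>\<one>\<close>, so
  both are trivial.\<close>

lemma (in comm_group) torsion_free_unique_product:
  assumes "torsion_free G" and A: "finite A" "A \<noteq> {}" "A \<subseteq> carrier G"
    and B: "finite B" "B \<noteq> {}" "B \<subseteq> carrier G"
  obtains a b where "a \<in> A" "b \<in> B"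
    "\<And>a' b'. a' \<in> A \<Longrightarrow> b' \<in> B \<Longrightarrow> a' \<otimes> b' = a \<otimes> b \<Longrightarrow> a' = a \<and> b' = b"
proof -
  obtain P where P: "cone P" and tot: "\<And>x. x \<in> carrier G \<Longrightarrow> x \<in> P \<or> inv x \<in> P"
    using torsion_free_total_cone[OF assms(1)] by blast
  have greatest: "\<exists>m\<in>A. \<forall>a\<in>A. m \<otimes> inv a \<in> P"
    if "finite A" "A \<noteq> {}" "A \<subseteq> carrier G" for A
    using that
  proof (induction rule: finite_ne_induct)
    case (singleton x)
    then show ?case using P by (auto simp: cone_def)
  next
    case (insert x F)
    then obtain m where m: "m \<in> F" "\<forall>a\<in>F. m \<otimes> inv a \<in> P" by auto
    have xm: "x \<in> carrier G" "m \<in> carrier G" "F \<subseteq> carrier G" using insert m by auto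
    show ?case
    proof (cases "m \<otimes> inv x \<in> P")
      case True
      then show ?thesis using m by auto
    next
      case False
      then have "x \<otimes> inv m \<in> P"
        using tot[of "m \<otimes> inv x"] xm by (simp add: inv_mult m_comm)
      then have "x \<otimes> inv a \<in> P" if "a \<in> F" for a
      proof -
        have a: "a \<in> carrier G" using xm that by auto
        have "(x \<otimes> inv m) \<otimes> (m \<otimes> inv a) = x \<otimes> ((inv m \<otimes> m) \<otimes> inv a)"
          using xm a by (simp only: m_assoc inv_closed m_closed)
        also have "\<dots> = x \<otimes> inv a" using xm a by simp
        finally have "x \<otimes> inv a = (x \<otimes> inv m) \<otimes> (m \<otimes> inv a)" by simp
        then show ?thesis using P \<open>x \<otimes> inv m \<in> P\<close> m that by (auto simp: cone_def)
      qed
      moreover have "x \<otimes> inv x \<in> P" using P xm by (auto simp: cone_def)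
      ultimately show ?thesis by auto
    qed
  qed
  obtain a where a: "a \<in> A" "\<forall>a'\<in>A. a \<otimes> inv a' \<in> P" using greatest[OF A] by blast
  obtain b where b: "b \<in> B" "\<forall>b'\<in>B. b \<otimes> inv b' \<in> P" using greatest[OF B] by blast
  have "a' = a \<and> b' = b" if "a' \<in> A" "b' \<in> B" "a' \<otimes> b' = a \<otimes> b" for a' b'
  proof -
    have c: "a \<in> carrier G" "b \<in> carrier G" "a' \<in> carrier G" "b' \<in> carrier G"
      using a b that A B by auto
    have "(a \<otimes> inv a') \<otimes> (b \<otimes> inv b') = (a \<otimes> b) \<otimes> inv (a' \<otimes> b')"
      using c by (simp add: inv_mult m_ac)
    also have "\<dots> = \<one>" using c that by simp
    finally have "inv (a \<otimes> inv a') = b \<otimes> inv b'"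
      using c inv_equality[of "b \<otimes> inv b'" "a \<otimes> inv a'"]
        m_comm[of "a \<otimes> inv a'" "b \<otimes> inv b'"] by simp
    then have "a \<otimes> inv a' = \<one>" using P a b that by (auto simp: cone_def)
    then have "a' = a" using c inv_equality[of a "inv a'"] by simp
    then show ?thesis using that c by simp
  qed
  with a b that show thesis by blast
qed


section \<open>Graded rings\<close>

locale graded = \<Gamma>: comm_group \<Gamma> + D: ring D
  for \<Gamma> :: "('g, 'z) monoid_scheme" and C :: "'g \<Rightarrow> 'd set" and D :: "('d, 'y) ring_scheme" +
  assumes graded: "graded_ring \<Gamma> C D"
begin

text \<open>Decompositions are extensional functions, so for \<open>x\<close> in \<open>D\<close>
  there is literally one of them. Its values outside the grading group carry no meaning, which is
  why \<open>supp\<close> is cut down to the carrier.\<close>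

definition component :: "'d \<Rightarrow> 'g \<Rightarrow> 'd" where
  "component x = (THE f. homogeneous_decomposition \<Gamma> C D x f)"

abbreviation "supp x \<equiv> {\<gamma> \<in> carrier \<Gamma>. component x \<gamma> \<noteq> \<zero>\<^bsub>D\<^esub>}"

lemma C_subgroup: "\<gamma> \<in> carrier \<Gamma> \<Longrightarrow> additive_subgroup (C \<gamma>) D"
  using graded by (simp add: graded_ring_def)

lemma C_carrier: "\<gamma> \<in> carrier \<Gamma> \<Longrightarrow> x \<in> C \<gamma> \<Longrightarrow> x \<in> carrier D"
  using additive_subgroup.a_Hcarr[OF C_subgroup] .

lemma C_zero: "\<gamma> \<in> carrier \<Gamma> \<Longrightarrow> \<zero>\<^bsub>D\<^esub> \<in> C \<gamma>"
  using additive_subgroup.zero_closed[OF C_subgroup] .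

lemma C_mult:
  "\<gamma> \<in> carrier \<Gamma> \<Longrightarrow> \<delta> \<in> carrier \<Gamma> \<Longrightarrow> x \<in> C \<gamma> \<Longrightarrow> y \<in> C \<delta> \<Longrightarrow> x \<otimes>\<^bsub>D\<^esub> y \<in> C (\<gamma> \<otimes>\<^bsub>\<Gamma>\<^esub> \<delta>)"
  using graded by (simp add: graded_ring_def)

lemma component_decomposition:
  assumes "x \<in> carrier D"
  shows "homogeneous_decomposition \<Gamma> C D x (component x)"
  unfolding component_def by (rule theI'[of "homogeneous_decomposition \<Gamma> C D x"]) (use graded assms in \<open>simp add: graded_ring_def\<close>)

lemma component_in_C: "x \<in> carrier D \<Longrightarrow> \<gamma> \<in> carrier \<Gamma> \<Longrightarrow> component x \<gamma> \<in> C \<gamma>"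
  and finite_supp: "x \<in> carrier D \<Longrightarrow> finite (supp x)"
  and component_sum: "x \<in> carrier D \<Longrightarrow> x = (\<Oplus>\<^bsub>D\<^esub>\<gamma>\<in>supp x. component x \<gamma>)"
  using component_decomposition[of x] unfolding homogeneous_decomposition_def by blast+

lemma component_closed: "x \<in> carrier D \<Longrightarrow> \<gamma> \<in> carrier \<Gamma> \<Longrightarrow> component x \<gamma> \<in> carrier D"
  using component_in_C C_carrier by blast

text \<open>Components can be read off any finite expansion into homogeneous terms: \<open>S\<close>
  may exceed the support, and \<open>f\<close> need not be extensional.\<close>

lemma component_eqI:
  assumes S: "finite S" "S \<subseteq> carrier \<Gamma>"
    and f: "\<And>\<gamma>. \<gamma> \<in> carrier \<Gamma> \<Longrightarrow> f \<gamma> \<in> C \<gamma>"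
    and zero: "\<And>\<gamma>. \<gamma> \<in> carrier \<Gamma> \<Longrightarrow> \<gamma> \<notin> S \<Longrightarrow> f \<gamma> = \<zero>\<^bsub>D\<^esub>"
    and x: "x = (\<Oplus>\<^bsub>D\<^esub>\<gamma>\<in>S. f \<gamma>)" and \<gamma>: "\<gamma> \<in> carrier \<Gamma>"
  shows "component x \<gamma> = f \<gamma>"
proof -
  let ?f = "restrict f (carrier \<Gamma>)"
  have fD: "f \<gamma> \<in> carrier D" if "\<gamma> \<in> carrier \<Gamma>" for \<gamma> using f C_carrier that by blast
  have xD: "x \<in> carrier D" unfolding x using S fD by (intro D.finsum_closed) auto
  have sub: "{\<gamma> \<in> carrier \<Gamma>. ?f \<gamma> \<noteq> \<zero>\<^bsub>D\<^esub>} \<subseteq> S" using zero by auto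
  have "x = (\<Oplus>\<^bsub>D\<^esub>\<gamma>\<in>{\<gamma> \<in> carrier \<Gamma>. ?f \<gamma> \<noteq> \<zero>\<^bsub>D\<^esub>}. ?f \<gamma>)"
    unfolding x
    by (rule D.add.finprod_mono_neutral_cong_right) (use S sub fD in auto)
  moreover have "finite {\<gamma> \<in> carrier \<Gamma>. ?f \<gamma> \<noteq> \<zero>\<^bsub>D\<^esub>}"
    using sub S finite_subset by blast
  ultimately have "homogeneous_decomposition \<Gamma> C D x ?f"
    using f by (simp add: homogeneous_decomposition_def)
  moreover have "\<exists>!f. homogeneous_decomposition \<Gamma> C D x f"
    using graded xD by (simp add: graded_ring_def)
  ultimately have "component x = ?f"
    using component_decomposition[OF xD] by blast
  then show ?thesis using \<gamma> by simp
qed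

lemma component_homogeneous:
  assumes "\<gamma> \<in> carrier \<Gamma>" "x \<in> C \<gamma>" "\<delta> \<in> carrier \<Gamma>"
  shows "component x \<delta> = (if \<delta> = \<gamma> then x else \<zero>\<^bsub>D\<^esub>)"
  by (rule component_eqI[of "{\<gamma>}" "\<lambda>\<delta>. if \<delta> = \<gamma> then x else \<zero>\<^bsub>D\<^esub>"])
     (use assms C_carrier C_zero in auto)

lemma component_add:
  assumes "x \<in> carrier D" "y \<in> carrier D" "\<delta> \<in> carrier \<Gamma>"
  shows "component (x \<oplus>\<^bsub>D\<^esub> y) \<delta> = component x \<delta> \<oplus>\<^bsub>D\<^esub> component y \<delta>"
proof (rule component_eqI[of "supp x \<union> supp y" "\<lambda>\<delta>. component x \<delta> \<oplus>\<^bsub>D\<^esub> component y \<delta>"])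
  \<comment> \<open>Both summands are expanded over one common index set, so that the sums can be
    added termwise.\<close>
  have ext: "z = (\<Oplus>\<^bsub>D\<^esub>\<gamma>\<in>supp x \<union> supp y. component z \<gamma>)"
    if "z \<in> carrier D" "supp z \<subseteq> supp x \<union> supp y" for z
  proof -
    have "(\<Oplus>\<^bsub>D\<^esub>\<gamma>\<in>supp z. component z \<gamma>) = (\<Oplus>\<^bsub>D\<^esub>\<gamma>\<in>supp x \<union> supp y. component z \<gamma>)"
      by (rule D.add.finprod_mono_neutral_cong_left)
         (use that assms finite_supp component_closed in auto)
    then show ?thesis using component_sum[OF that(1)] by simp
  qed
  have "x \<oplus>\<^bsub>D\<^esub> y = (\<Oplus>\<^bsub>D\<^esub>\<gamma>\<in>supp x \<union> supp y. component x \<gamma>) \<oplus>\<^bsub>D\<^esub> (\<Oplus>\<^bsub>D\<^esub>\<gamma>\<in>supp x \<union> supp y. component y \<gamma>)"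
    using ext[of x] ext[of y] assms by simp
  also have "\<dots> = (\<Oplus>\<^bsub>D\<^esub>\<gamma>\<in>supp x \<union> supp y. component x \<gamma> \<oplus>\<^bsub>D\<^esub> component y \<gamma>)"
    by (rule D.finsum_addf[symmetric]) (use assms component_closed in auto)
  finally show "x \<oplus>\<^bsub>D\<^esub> y = (\<Oplus>\<^bsub>D\<^esub>\<gamma>\<in>supp x \<union> supp y. component x \<gamma> \<oplus>\<^bsub>D\<^esub> component y \<gamma>)" .
qed (use assms finite_supp component_in_C additive_subgroup.a_closed[OF C_subgroup] in auto)

lemma component_hom:
  assumes "\<delta> \<in> carrier \<Gamma>"
  shows "abelian_group_hom D D (\<lambda>x. component x \<delta>)"
proof -
  have "(\<lambda>x. component x \<delta>) \<in> hom (add_monoid D) (add_monoid D)"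
    using assms by (auto simp: hom_def component_add component_closed)
  then show ?thesis
    by (intro abelian_group_homI group_hom.intro group_hom_axioms.intro D.abelian_group_axioms
        D.a_group)
qed

lemma component_finsum:
  assumes "finite S" "\<And>i. i \<in> S \<Longrightarrow> f i \<in> carrier D" "\<delta> \<in> carrier \<Gamma>"
  shows "component (\<Oplus>\<^bsub>D\<^esub>i\<in>S. f i) \<delta> = (\<Oplus>\<^bsub>D\<^esub>i\<in>S. component (f i) \<delta>)"
proof -
  interpret h: abelian_group_hom D D "\<lambda>x. component x \<delta>" by (rule component_hom[OF assms(3)])
  show ?thesis
    using assms(1,2) by (induction rule: finite_induct) (simp_all add: Pi_def)
qed

lemma homogeneous_induct [consumes 1, case_names zero add homogeneous]:
  assumes "x \<in> carrier D" "P \<zero>\<^bsub>D\<^esub>"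
    and add: "\<And>x y. x \<in> carrier D \<Longrightarrow> y \<in> carrier D \<Longrightarrow> P x \<Longrightarrow> P y \<Longrightarrow> P (x \<oplus>\<^bsub>D\<^esub> y)"
    and hom: "\<And>x. x \<in> homogeneous_elements \<Gamma> C \<Longrightarrow> P x"
  shows "P x"
proof -
  have "P (\<Oplus>\<^bsub>D\<^esub>\<gamma>\<in>S. component x \<gamma>)" if "finite S" "S \<subseteq> carrier \<Gamma>" for S
    using that
  proof (induction rule: finite_induct)
    case (insert \<gamma> S)
    have "P (component x \<gamma>)"
      using hom component_in_C assms(1) insert by (auto simp: homogeneous_elements_def)
    moreover have "component x \<in> S \<rightarrow> carrier D" "component x \<gamma> \<in> carrier D"
      using insert component_closed assms(1) by auto
    ultimately show ?case
      using insert by (simp add: add)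
  qed (simp add: assms)
  from this[OF finite_supp[OF assms(1)]] show ?thesis
    using component_sum[OF assms(1)] by auto
qed

lemma homogeneous_carrier: "x \<in> homogeneous_elements \<Gamma> C \<Longrightarrow> x \<in> carrier D"
  using C_carrier by (auto simp: homogeneous_elements_def)

text \<open>By the choice of \<open>a\<close> and \<open>b\<close>, exactly one pair of degrees
  contributes to the component of the product in degree \<open>a \<otimes> b\<close>. That component
  is the product of two non-zero homogeneous elements, and the first of them is a unit.\<close>

lemma graded_integral:
  assumes "torsion_free \<Gamma>" "graded_division_ring \<Gamma> C D"
    and x: "x \<in> carrier D" "x \<noteq> \<zero>\<^bsub>D\<^esub>" and y: "y \<in> carrier D" "y \<noteq> \<zero>\<^bsub>D\<^esub>"
  shows "x \<otimes>\<^bsub>D\<^esub> y \<noteq> \<zero>\<^bsub>D\<^esub>"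
proof
  assume xy: "x \<otimes>\<^bsub>D\<^esub> y = \<zero>\<^bsub>D\<^esub>"
  have ne: "supp z \<noteq> {}" if "z \<in> carrier D" "z \<noteq> \<zero>\<^bsub>D\<^esub>" for z
  proof
    assume "supp z = {}"
    then show False using component_sum[OF that(1)] that(2) by (simp only: D.finsum_empty)
  qed
  obtain a b where ab: "a \<in> supp x" "b \<in> supp y"
    and uniq: "\<And>a' b'. a' \<in> supp x \<Longrightarrow> b' \<in> supp y \<Longrightarrow> a' \<otimes>\<^bsub>\<Gamma>\<^esub> b' = a \<otimes>\<^bsub>\<Gamma>\<^esub> b \<Longrightarrow> a' = a \<and> b' = b"
    by (rule \<Gamma>.torsion_free_unique_product[OF assms(1) finite_supp[OF x(1)] ne[OF x] _
        finite_supp[OF y(1)] ne[OF y]]) blast+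
  let ?d = "a \<otimes>\<^bsub>\<Gamma>\<^esub> b"
  have d: "?d \<in> carrier \<Gamma>" using ab by simp
  note fin = finite_supp[OF x(1)] finite_supp[OF y(1)]
  have cx: "component x a' \<in> carrier D" if "a' \<in> supp x" for a' using component_closed x that by simp
  have cy: "component y b' \<in> carrier D" if "b' \<in> supp y" for b' using component_closed y that by simp
  \<comment> \<open>The nested conditionals let the sum over \<open>b'\<close> and then the sum over
    \<open>a'\<close> each collapse to a single term.\<close>
  have inner: "component (component x a' \<otimes>\<^bsub>D\<^esub> component y b') ?d =
      (if b = b' then if a = a' then component x a \<otimes>\<^bsub>D\<^esub> component y b else \<zero>\<^bsub>D\<^esub> else \<zero>\<^bsub>D\<^esub>)"
    if "a' \<in> supp x" "b' \<in> supp y" for a' b'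
  proof -
    have "component x a' \<otimes>\<^bsub>D\<^esub> component y b' \<in> C (a' \<otimes>\<^bsub>\<Gamma>\<^esub> b')"
      using that x y by (intro C_mult component_in_C) auto
    then have "component (component x a' \<otimes>\<^bsub>D\<^esub> component y b') ?d =
        (if ?d = a' \<otimes>\<^bsub>\<Gamma>\<^esub> b' then component x a' \<otimes>\<^bsub>D\<^esub> component y b' else \<zero>\<^bsub>D\<^esub>)"
      using that d by (intro component_homogeneous) auto
    then show ?thesis using uniq[OF that] by auto
  qed
  have prod: "component x a \<otimes>\<^bsub>D\<^esub> component y b \<in> carrier D" using cx[OF ab(1)] cy[OF ab(2)] by simp
  have row: "component (component x a' \<otimes>\<^bsub>D\<^esub> y) ?d =
      (if a = a' then component x a \<otimes>\<^bsub>D\<^esub> component y b else \<zero>\<^bsub>D\<^esub>)" if a': "a' \<in> supp x" for a'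
  proof -
    have "component x a' \<otimes>\<^bsub>D\<^esub> y = (\<Oplus>\<^bsub>D\<^esub>b'\<in>supp y. component x a' \<otimes>\<^bsub>D\<^esub> component y b')"
      using component_sum[OF y(1)] D.finsum_rdistr[OF fin(2) cx[OF a'], of "component y"] cy by auto
    then have "component (component x a' \<otimes>\<^bsub>D\<^esub> y) ?d =
        (\<Oplus>\<^bsub>D\<^esub>b'\<in>supp y. component (component x a' \<otimes>\<^bsub>D\<^esub> component y b') ?d)"
      using component_finsum[OF fin(2) _ d, of "\<lambda>b'. component x a' \<otimes>\<^bsub>D\<^esub> component y b'"] cx[OF a'] cy by simp
    also have "\<dots> = (\<Oplus>\<^bsub>D\<^esub>b'\<in>supp y. if b = b'
        then (if a = a' then component x a \<otimes>\<^bsub>D\<^esub> component y b else \<zero>\<^bsub>D\<^esub>) else \<zero>\<^bsub>D\<^esub>)"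
      using inner[OF a'] prod by (intro D.finsum_cong') auto
    also have "\<dots> = (if a = a' then component x a \<otimes>\<^bsub>D\<^esub> component y b else \<zero>\<^bsub>D\<^esub>)"
      by (rule D.add.finprod_singleton[OF ab(2) fin(2)]) (use prod in auto)
    finally show ?thesis .
  qed
  have "x \<otimes>\<^bsub>D\<^esub> y = (\<Oplus>\<^bsub>D\<^esub>a'\<in>supp x. component x a' \<otimes>\<^bsub>D\<^esub> y)"
    using component_sum[OF x(1)] D.finsum_ldistr[OF fin(1) y(1), of "component x"] cx by auto
  then have "component (x \<otimes>\<^bsub>D\<^esub> y) ?d = (\<Oplus>\<^bsub>D\<^esub>a'\<in>supp x. component (component x a' \<otimes>\<^bsub>D\<^esub> y) ?d)"
    using component_finsum[OF fin(1) _ d, of "\<lambda>a'. component x a' \<otimes>\<^bsub>D\<^esub> y"] cx y by simp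
  also have "\<dots> = (\<Oplus>\<^bsub>D\<^esub>a'\<in>supp x. if a = a' then component x a \<otimes>\<^bsub>D\<^esub> component y b else \<zero>\<^bsub>D\<^esub>)"
    using row prod by (intro D.finsum_cong') auto
  also have "\<dots> = component x a \<otimes>\<^bsub>D\<^esub> component y b"
    by (rule D.add.finprod_singleton[OF ab(1) fin(1)]) (use prod in auto)
  finally have "component x a \<otimes>\<^bsub>D\<^esub> component y b = \<zero>\<^bsub>D\<^esub>"
    using xy component_homogeneous[OF _ C_zero d, of ?d] d by simp
  moreover have "component x a \<in> Units D"
    using assms(2) ab(1) component_in_C[OF x(1)]
    by (auto simp: graded_division_ring_def homogeneous_elements_def)
  ultimately have "component y b = \<zero>\<^bsub>D\<^esub>"
    using cy[OF ab(2)] D.Units_l_cancel[of "component x a" "component y b" "\<zero>\<^bsub>D\<^esub>"] D.Units_closed by simp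
  then show False using ab by simp
qed

section \<open>The additive span of the homogeneous commutators\<close>

abbreviation "hcomm \<equiv> commutators D (homogeneous_elements \<Gamma> C)"
text \<open>Scalars are left out on purpose: inclusion in any submodule containing
  \<open>hcomm\<close> is then immediate, and stability under the centre is proved
  afterwards.\<close>

definition "comm_span = generate (add_monoid D) hcomm"

lemma commutators_carrier: "S \<subseteq> carrier D \<Longrightarrow> commutators D S \<subseteq> carrier D"
  by (auto simp: commutators_def)

lemma hcomm_carrier: "hcomm \<subseteq> carrier D"
  using homogeneous_carrier by (intro commutators_carrier) auto

lemma comm_span_subgroup: "additive_subgroup comm_span D"
  unfolding comm_span_def using hcomm_carrier
  by (intro additive_subgroupI group.generate_is_subgroup D.a_group) simp

text \<open>A submodule is in particular an additive subgroup. This is the lower bound for both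
  notions of generated submodule.\<close>

lemma comm_span_subset: "submodule N K (restrict_scalars \<phi> D) \<Longrightarrow> hcomm \<subseteq> N \<Longrightarrow> comm_span \<subseteq> N"
proof -
  assume N: "submodule N K (restrict_scalars \<phi> D)" and "hcomm \<subseteq> N"
  have "subgroup N (add_monoid D)"
    using submodule.axioms(1)[OF N] by (simp add: subgroup_def m_inv_def)
  with \<open>hcomm \<subseteq> N\<close> show "comm_span \<subseteq> N"
    unfolding comm_span_def by (rule group.generate_subgroup_incl[OF D.a_group])
qed

sublocale A: additive_subgroup comm_span D by (rule comm_span_subgroup)

text \<open>The commutator is biadditive and every element is a sum of homogeneous ones; the two
  arguments are expanded one after the other.\<close>

lemma commutators_comm_span: "commutators D (carrier D) \<subseteq> comm_span"
proof -
  have 1: "a \<otimes>\<^bsub>D\<^esub> b \<ominus>\<^bsub>D\<^esub> b \<otimes>\<^bsub>D\<^esub> a \<in> comm_span"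
    if "a \<in> carrier D" "b \<in> homogeneous_elements \<Gamma> C" for a b
    using that
  proof (induction rule: homogeneous_induct)
    case zero
    then show ?case using homogeneous_carrier[of b] by (simp add: a_minus_def)
  next
    case (add x y)
    have "(x \<oplus>\<^bsub>D\<^esub> y) \<otimes>\<^bsub>D\<^esub> b \<ominus>\<^bsub>D\<^esub> b \<otimes>\<^bsub>D\<^esub> (x \<oplus>\<^bsub>D\<^esub> y) =
        (x \<otimes>\<^bsub>D\<^esub> b \<ominus>\<^bsub>D\<^esub> b \<otimes>\<^bsub>D\<^esub> x) \<oplus>\<^bsub>D\<^esub> (y \<otimes>\<^bsub>D\<^esub> b \<ominus>\<^bsub>D\<^esub> b \<otimes>\<^bsub>D\<^esub> y)"
      using add homogeneous_carrier[of b]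
      by (simp add: a_minus_def D.l_distr D.r_distr D.minus_add D.a_ac)
    then show ?case using add by simp
  next
    case (homogeneous x)
    then show ?case unfolding comm_span_def by (intro generate.incl) (auto simp: commutators_def)
  qed
  have "a \<otimes>\<^bsub>D\<^esub> b \<ominus>\<^bsub>D\<^esub> b \<otimes>\<^bsub>D\<^esub> a \<in> comm_span"
    if "b \<in> carrier D" "a \<in> carrier D" for a b
    using that
  proof (induction rule: homogeneous_induct)
    case zero
    then show ?case by (simp add: a_minus_def)
  next
    case (add x y)
    have "a \<otimes>\<^bsub>D\<^esub> (x \<oplus>\<^bsub>D\<^esub> y) \<ominus>\<^bsub>D\<^esub> (x \<oplus>\<^bsub>D\<^esub> y) \<otimes>\<^bsub>D\<^esub> a =
        (a \<otimes>\<^bsub>D\<^esub> x \<ominus>\<^bsub>D\<^esub> x \<otimes>\<^bsub>D\<^esub> a) \<oplus>\<^bsub>D\<^esub> (a \<otimes>\<^bsub>D\<^esub> y \<ominus>\<^bsub>D\<^esub> y \<otimes>\<^bsub>D\<^esub> a)"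
      using add
      by (simp add: a_minus_def D.l_distr D.r_distr D.minus_add D.a_ac)
    then show ?case using add by simp
  next
    case (homogeneous x)
    then show ?case using 1 by simp
  qed
  then show ?thesis by (auto simp: commutators_def)
qed

lemma comm_span_induct [consumes 1, case_names zero add uminus commutator]:
  assumes "x \<in> comm_span" "P \<zero>\<^bsub>D\<^esub>"
    and "\<And>x y. x \<in> comm_span \<Longrightarrow> y \<in> comm_span \<Longrightarrow> P x \<Longrightarrow> P y \<Longrightarrow> P (x \<oplus>\<^bsub>D\<^esub> y)"
    and uminus: "\<And>x. x \<in> comm_span \<Longrightarrow> P x \<Longrightarrow> P (\<ominus>\<^bsub>D\<^esub> x)"
    and comm: "\<And>x. x \<in> hcomm \<Longrightarrow> P x"
  shows "P x"
proof -
  have "x \<in> generate (add_monoid D) hcomm" using assms(1) by (simp add: comm_span_def)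
  then show ?thesis
  proof induction
    case (inv h)
    then have "P (\<ominus>\<^bsub>D\<^esub> h)"
      unfolding comm_span_def by (intro uminus comm) (auto simp: comm_span_def intro: generate.incl)
    then show ?case by (simp add: a_inv_def)
  next
    case (eng h1 h2)
    then show ?case using assms(3)[of h1 h2] by (simp add: comm_span_def)
  qed (use assms in simp_all)
qed

text \<open>Because the grading group is abelian, \<open>a b\<close> and \<open>b a\<close> have the
  same degree for homogeneous \<open>a\<close> and \<open>b\<close>, so the generators are
  themselves homogeneous. Taking a component is additive, which carries the claim to the whole
  span.\<close>

lemma comm_span_component:
  assumes "x \<in> comm_span" "\<delta> \<in> carrier \<Gamma>"
  shows "component x \<delta> \<in> comm_span"
proof -
  interpret h: abelian_group_hom D D "\<lambda>x. component x \<delta>" by (rule component_hom[OF assms(2)])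
  from assms(1) show ?thesis
  proof (induction rule: comm_span_induct)
    case (commutator x)
    then obtain \<alpha> \<beta> a b where ab: "\<alpha> \<in> carrier \<Gamma>" "\<beta> \<in> carrier \<Gamma>" "a \<in> C \<alpha>" "b \<in> C \<beta>"
      "x = a \<otimes>\<^bsub>D\<^esub> b \<ominus>\<^bsub>D\<^esub> b \<otimes>\<^bsub>D\<^esub> a"
      by (auto simp: commutators_def homogeneous_elements_def)
    interpret Cab: additive_subgroup "C (\<alpha> \<otimes>\<^bsub>\<Gamma>\<^esub> \<beta>)" D using ab by (simp add: C_subgroup)
    have "a \<otimes>\<^bsub>D\<^esub> b \<in> C (\<alpha> \<otimes>\<^bsub>\<Gamma>\<^esub> \<beta>)" "b \<otimes>\<^bsub>D\<^esub> a \<in> C (\<alpha> \<otimes>\<^bsub>\<Gamma>\<^esub> \<beta>)"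
      using C_mult[of \<alpha> \<beta> a b] C_mult[of \<beta> \<alpha> b a] ab by (simp_all add: \<Gamma>.m_comm)
    then have "x \<in> C (\<alpha> \<otimes>\<^bsub>\<Gamma>\<^esub> \<beta>)" using ab by (simp add: a_minus_def)
    moreover have "x \<in> comm_span"
      using commutator unfolding comm_span_def by (rule generate.incl)
    ultimately show ?case
      using component_homogeneous[of "\<alpha> \<otimes>\<^bsub>\<Gamma>\<^esub> \<beta>" x \<delta>] ab assms(2) by simp
  qed simp_all
qed

end

section \<open>The centre and the commutator submodule over it\<close>

lemma centre_simps:
  "carrier (ring_centre D) = {z \<in> carrier D. \<forall>x\<in>carrier D. z \<otimes>\<^bsub>D\<^esub> x = x \<otimes>\<^bsub>D\<^esub> z}"
  "monoid.mult (ring_centre D) = monoid.mult D" "monoid.one (ring_centre D) = monoid.one D"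
  "ring.add (ring_centre D) = ring.add D" "ring.zero (ring_centre D) = ring.zero D"
  by (simp_all add: ring_centre_def)

lemma cring_centre:
  assumes "ring D"
  shows "cring (ring_centre D)"
proof -
  interpret D: ring D by fact
  let ?Z = "carrier (ring_centre D)"
  have Z: "z \<in> carrier D" "x \<in> carrier D \<Longrightarrow> z \<otimes>\<^bsub>D\<^esub> x = x \<otimes>\<^bsub>D\<^esub> z" if "z \<in> ?Z" for z x
    using that by (simp_all add: centre_simps)
  have Z_I: "z \<in> ?Z" if "z \<in> carrier D" "\<And>x. x \<in> carrier D \<Longrightarrow> z \<otimes>\<^bsub>D\<^esub> x = x \<otimes>\<^bsub>D\<^esub> z" for z
    using that by (simp add: centre_simps)
  have "subring ?Z D"
  proof (rule D.subringI)
    show "?Z \<subseteq> carrier D" using Z(1) by blast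
    show "\<one>\<^bsub>D\<^esub> \<in> ?Z" by (rule Z_I) simp_all
  next
    fix z assume z: "z \<in> ?Z"
    show "\<ominus>\<^bsub>D\<^esub> z \<in> ?Z" 
    proof (rule Z_I)
      fix x assume "x \<in> carrier D"
      then show "\<ominus>\<^bsub>D\<^esub> z \<otimes>\<^bsub>D\<^esub> x = x \<otimes>\<^bsub>D\<^esub> \<ominus>\<^bsub>D\<^esub> z"
        using Z(1)[OF z] by (simp add: D.l_minus D.r_minus Z(2)[OF z])
    qed (use Z(1)[OF z] in simp)
  next
    fix z w assume zw: "z \<in> ?Z" "w \<in> ?Z"
    note c = Z(1)[OF zw(1)] Z(1)[OF zw(2)]
    show "z \<otimes>\<^bsub>D\<^esub> w \<in> ?Z"
    proof (rule Z_I)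
      fix x assume x: "x \<in> carrier D"
      have "(z \<otimes>\<^bsub>D\<^esub> w) \<otimes>\<^bsub>D\<^esub> x = z \<otimes>\<^bsub>D\<^esub> (x \<otimes>\<^bsub>D\<^esub> w)"
        using c x by (simp only: D.m_assoc Z(2)[OF zw(2) x])
      also have "\<dots> = (x \<otimes>\<^bsub>D\<^esub> z) \<otimes>\<^bsub>D\<^esub> w"
        using c x by (simp only: D.m_assoc[symmetric] Z(2)[OF zw(1) x])
      also have "\<dots> = x \<otimes>\<^bsub>D\<^esub> (z \<otimes>\<^bsub>D\<^esub> w)" using c x by (simp only: D.m_assoc)
      finally show "(z \<otimes>\<^bsub>D\<^esub> w) \<otimes>\<^bsub>D\<^esub> x = x \<otimes>\<^bsub>D\<^esub> (z \<otimes>\<^bsub>D\<^esub> w)" .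
    qed (use c in simp)
    show "z \<oplus>\<^bsub>D\<^esub> w \<in> ?Z"
    proof (rule Z_I)
      fix x assume "x \<in> carrier D"
      then show "(z \<oplus>\<^bsub>D\<^esub> w) \<otimes>\<^bsub>D\<^esub> x = x \<otimes>\<^bsub>D\<^esub> (z \<oplus>\<^bsub>D\<^esub> w)"
        using c by (simp add: D.l_distr D.r_distr Z(2)[OF zw(1)] Z(2)[OF zw(2)])
    qed (use c in simp)
  qed
  then have "subcring ?Z D"
    using Z by (intro D.subcringI) simp_all
  then have "cring (D\<lparr>carrier := ?Z\<rparr>)"
    using D.subcring_iff[of ?Z] Z(1) by blast
  then show ?thesis by (simp add: ring_centre_def)
qed

lemma centre_hom: "id \<in> ring_hom (ring_centre D) D"
proof (rule ring_hom_memI)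
  show "id x \<in> carrier D" if "x \<in> carrier (ring_centre D)" for x
    using that by (simp add: centre_simps)
qed (simp_all add: centre_simps(2-5))

context graded
begin

abbreviation "F \<equiv> ring_centre D"

lemma F_cring: "cring F"
  by (rule cring_centre) (rule D.ring_axioms)

lemma F_domain:
  assumes "torsion_free \<Gamma>" "graded_division_ring \<Gamma> C D"
  shows "domain F"
proof -
  interpret F: cring F by (rule F_cring)
  show ?thesis
  proof (rule domain.intro[OF F_cring], rule domain_axioms.intro)
    show "\<one>\<^bsub>F\<^esub> \<noteq> \<zero>\<^bsub>F\<^esub>" using assms(2) by (simp add: graded_division_ring_def centre_simps(2-5))
  next
    fix a b assume "a \<otimes>\<^bsub>F\<^esub> b = \<zero>\<^bsub>F\<^esub>" "a \<in> carrier F" "b \<in> carrier F"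
    moreover have "x \<in> carrier D" if "x \<in> carrier F" for x using that by (simp add: centre_simps(1))
    ultimately show "a = \<zero>\<^bsub>F\<^esub> \<or> b = \<zero>\<^bsub>F\<^esub>"
      using graded_integral[OF assms, of a b] by (auto simp: centre_simps(2-5))
  qed
qed

abbreviation "MF \<equiv> restrict_scalars id D :: ('d, 'd) module"

lemma MF_module: "module F MF"
  by (intro restrict_scalars_module F_cring D.ring_axioms centre_hom)

text \<open>A central \<open>z\<close> need not be homogeneous, so
  \<open>z [a, b] = [z a, b]\<close> may leave the set of generators;
  \<open>commutators_comm_span\<close> brings it back into the span.\<close>

lemma comm_span_submodule: "submodule comm_span F MF"
proof -
  interpret M: module F MF by (rule MF_module)
  have inv: "\<ominus>\<^bsub>MF\<^esub> x = \<ominus>\<^bsub>D\<^esub> x" for x by (simp add: a_inv_def m_inv_def)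
  have smult: "z \<otimes>\<^bsub>D\<^esub> x \<in> comm_span" if "x \<in> comm_span" and z: "z \<in> carrier F" for z x
  proof -
    have zD: "z \<in> carrier D" using z by (simp add: centre_simps(1))
    from that(1) show ?thesis
    proof (induction rule: comm_span_induct)
      case (commutator x)
      then obtain a b where ab: "a \<in> carrier D" "b \<in> carrier D" "x = a \<otimes>\<^bsub>D\<^esub> b \<ominus>\<^bsub>D\<^esub> b \<otimes>\<^bsub>D\<^esub> a"
        using homogeneous_carrier by (auto simp: commutators_def)
      have "b \<otimes>\<^bsub>D\<^esub> (z \<otimes>\<^bsub>D\<^esub> a) = z \<otimes>\<^bsub>D\<^esub> (b \<otimes>\<^bsub>D\<^esub> a)"
        using D.m_assoc[of b z a] D.m_assoc[of z b a] z ab by (simp add: centre_simps(1))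
      then have "z \<otimes>\<^bsub>D\<^esub> x = (z \<otimes>\<^bsub>D\<^esub> a) \<otimes>\<^bsub>D\<^esub> b \<ominus>\<^bsub>D\<^esub> b \<otimes>\<^bsub>D\<^esub> (z \<otimes>\<^bsub>D\<^esub> a)"
        using zD ab by (simp add: a_minus_def D.r_distr D.r_minus D.m_assoc)
      also have "\<dots> \<in> commutators D (carrier D)"
        unfolding commutators_def using zD ab(1,2) by blast
      finally show ?case using commutators_comm_span by blast
    qed (use zD A.a_Hcarr in \<open>simp_all add: D.r_distr D.r_minus\<close>)
  qed
  show ?thesis
    by (rule M.submoduleI) (use A.a_subset smult in \<open>auto simp: inv\<close>)
qed

lemma submodule_generated_comm_span:
  "submodule_generated F MF (commutators D (carrier D)) = comm_span"
proof
  have sub: "commutators D (carrier D) \<subseteq> carrier MF"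
    using commutators_carrier[of "carrier D"] by simp
  note gen = submodule_generated[OF MF_module sub]
  show "submodule_generated F MF (commutators D (carrier D)) \<subseteq> comm_span"
    by (rule gen(3)[OF comm_span_submodule commutators_comm_span])
  have "hcomm \<subseteq> commutators D (carrier D)"
    using homogeneous_carrier by (auto simp: commutators_def)
  then show "comm_span \<subseteq> submodule_generated F MF (commutators D (carrier D))"
    using gen(2) comm_span_subset[OF gen(1)] by blast
qed

text \<open>The span is itself a graded submodule, its components being those taken in
  \<open>D\<close>; and it lies in every competitor by \<open>comm_span_subset\<close>.\<close>

lemma graded_submodule_generated_comm_span:
  "graded_submodule_generated \<Gamma> C F MF hcomm = comm_span"
proof
  have "homogeneous_decomposition \<Gamma> (\<lambda>\<gamma>. comm_span \<inter> C \<gamma>) MF x (component x)" if x: "x \<in> comm_span" for x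
  proof -
    have xD: "x \<in> carrier D" using x by simp
    \<comment> \<open>\<open>finsum\<close> sees only the additive monoid, which the two records
      share although their types differ.\<close>
    have "finsum MF = (finsum D :: ('g \<Rightarrow> 'd) \<Rightarrow> _)" by (intro ext) (simp add: finsum_def finprod_def)
    then show ?thesis
      using component_decomposition[OF xD] comm_span_component[OF x]
      by (auto simp: homogeneous_decomposition_def PiE_iff)
  qed
  then have "graded_submodule \<Gamma> C F MF comm_span"
    using comm_span_submodule by (auto simp: graded_submodule_def)
  moreover have "hcomm \<subseteq> comm_span"
    unfolding comm_span_def by (auto intro: generate.incl)
  ultimately show "graded_submodule_generated \<Gamma> C F MF hcomm \<subseteq> comm_span"
    unfolding graded_submodule_generated_def by blast
  show "comm_span \<subseteq> graded_submodule_generated \<Gamma> C F MF hcomm"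
    unfolding graded_submodule_generated_def graded_submodule_def using comm_span_subset by blast
qed

end

theorem corollary6p4p5:
  fixes \<Gamma> :: "('g, 'z) monoid_scheme"
    and C :: "'g \<Rightarrow> 'd set"
    and D F :: "('d, 'y) ring_scheme"
  assumes "comm_group \<Gamma>" and "torsion_free \<Gamma>"
    and "graded_division_algebra \<Gamma> C D F"
    and "noetherian_ring F"
  shows "vector_space_isomorphic (quotient_field F)
           (extend_scalars_right F (graded_commutator_quotient \<Gamma> C D F)
              (to_quotient_field F) (quotient_field F))
           (commutator_quotient (quotient_field F) (quotient_division_ring F D))"
proof -
  have div: "graded_division_ring \<Gamma> C D" and F: "F = ring_centre D"
    using assms(3) by (simp_all add: graded_division_algebra_def)
  then have gr: "graded_ring \<Gamma> C D" by (simp add: graded_division_ring_def)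
  then have "ring D" by (simp add: graded_ring_def)
  interpret graded \<Gamma> C D
    by (intro graded.intro graded_axioms.intro assms(1) \<open>ring D\<close> gr)
  interpret F: domain F unfolding F by (rule F_domain[OF assms(2) div])
  interpret K: field "quotient_field F" by (rule F.field_QR)
  have central: "id r \<otimes>\<^bsub>D\<^esub> d = d \<otimes>\<^bsub>D\<^esub> id r" if "r \<in> carrier F" "d \<in> carrier D" for r d
    using that by (simp add: F centre_simps(1))
  \<comment> \<open>The centre acts on \<open>D\<close> through the inclusion, so
    \<open>\<psi>\<close> is \<open>id\<close> and \<open>restrict_scalars id D\<close> is the
    module \<open>MD\<close> of the locale.\<close>
  interpret B: central_base_change F "quotient_field F" D "to_quotient_field F" id
    by (intro central_base_change.intro central_base_change_axioms.intro F.is_cring K.is_cring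
        \<open>ring D\<close> F.to_quotient_field_hom central) (simp add: F centre_hom)
  \<comment> \<open>The base change divides by all commutators, the statement by the graded
    submodule of the homogeneous ones; \<open>comm_span\<close> identifies the two.\<close>
  have "B.ND = comm_span"
    unfolding B.ND_def unfolding F by (rule submodule_generated_comm_span)
  then have "graded_commutator_quotient \<Gamma> C D F = B.DN"
    by (simp add: graded_commutator_quotient_def F graded_submodule_generated_comm_span)
  then have V: "extend_scalars_right F (graded_commutator_quotient \<Gamma> C D F)
      (to_quotient_field F) (quotient_field F) = B.V"
    by (simp add: B.V_def)
  have W: "commutator_quotient (quotient_field F) (quotient_division_ring F D) = B.W"
    by (simp add: commutator_quotient_def quotient_division_ring_def B.NQ_def B.QD_def)
  show ?thesis
    unfolding vector_space_isomorphic_def V W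
    using K.field_axioms B.base_change_iso by blast
qed

end
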